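(* For every \(k\in\mathbb{N}\) there exist constants \(D_k\) and \(D_k'\), depending only on \(k\), such that for every graph \(G\) with a tree decomposition of adhesion \(k\) with parts \(P_1,\dots,P_\ell\) the following hold: (1) For each \(i\), let \(\widehat{P}_i\) be the trigraph obtained from \(P_i\) by adding, for each adhesion set \(S\) of the decomposition contained in \(V(P_i)\), a new vertex \(v_S\) joined by red edges to all vertices of \(S\) and to nothing else. Then \(\operatorname{tww}(G)\leq 2^k\max_{i\in[\ell]}\operatorname{tww}(\widehat{P}_i)+D_k\). (2) Assume \(k\geq 3\). For each \(i\), let \(\overline{P}_i\) be the trigraph obtained from \(P_i\) by making every pair of distinct vertices of every adhesion set contained in \(V(P_i)\) adjacent by a red edge. Then \(\operatorname{tww}(G)\leq \frac{2^k}{(k-1)!}\max_{i\in[\ell]} \operatorname{tww}(\overline{P}_i)^{k-1}+D_k'\).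
   Context: A tree decomposition of \(G\) is a pair \((T,\{B_t\}_{t\in V(T)})\) with \(T\) a tree and bags \(B_t\subseteq V(G)\) such that every vertex lies in some bag, the bags containing any fixed vertex form a subtree, and every edge lies within some bag. The parts are the induced subgraphs \(G[B_t]\). The adhesion sets are the sets \(B_s\cap B_t\) for \(st\in E(T)\), and the adhesion is their maximum size. A trigraph is a graph whose edges are partitioned into black and red edges. For distinct vertices \(x,y\), the contraction \(G/xy\) replaces \(x,y\) by a new vertex \(z\), keeps edges not incident to \(x,y\), joins \(z\) by a black edge to every common black neighbour of \(x,y\), and by a red edge to every other vertex adjacent to \(x\) or \(y\). The twin-width \(\operatorname{tww}\) is the minimum, over all sequences of contractions reducing the trigraph to one vertex, of the maximum red degree occurring. *)

theory Defs
  imports Complex_Main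
begin

section \<open>Graphs and trees\<close>

record 'a graph =
  verts :: "'a set"
  edges :: "'a set set"

definition pairs :: "'a set \<Rightarrow> 'a set set" where
  "pairs V = {{u, v} | u v. u \<in> V \<and> v \<in> V \<and> u \<noteq> v}"

definition simple_graph :: "'a graph \<Rightarrow> bool" where
  "simple_graph G \<longleftrightarrow> finite (verts G) \<and> edges G \<subseteq> pairs (verts G)"

definition induced :: "'a graph \<Rightarrow> 'a set \<Rightarrow> 'a graph" where
  "induced G U = \<lparr>verts = verts G \<inter> U, edges = {e \<in> edges G. e \<subseteq> U}\<rparr>"

definition connected_graph :: "'a graph \<Rightarrow> bool" where
  "connected_graph G \<longleftrightarrow>
     (\<forall>u \<in> verts G. \<forall>v \<in> verts G. (u, v) \<in> {(a, b). {a, b} \<in> edges G}\<^sup>*)"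

definition is_cycle :: "'a graph \<Rightarrow> 'a list \<Rightarrow> bool" where
  "is_cycle G xs \<longleftrightarrow> 3 \<le> length xs \<and> distinct xs \<and>
     (\<forall>i < length xs. {xs ! i, xs ! (Suc i mod length xs)} \<in> edges G)"

definition is_tree :: "'a graph \<Rightarrow> bool" where
  "is_tree T \<longleftrightarrow> simple_graph T \<and> verts T \<noteq> {} \<and> connected_graph T \<and> (\<nexists>xs. is_cycle T xs)"


section \<open>Tree decompositions\<close>

definition tree_decomposition :: "'a graph \<Rightarrow> 't graph \<Rightarrow> ('t \<Rightarrow> 'a set) \<Rightarrow> bool" where
  "tree_decomposition G T B \<longleftrightarrow>
     is_tree T \<and>
     (\<forall>t \<in> verts T. B t \<subseteq> verts G) \<and>
     (\<forall>v \<in> verts G. \<exists>t \<in> verts T. v \<in> B t) \<and>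
     (\<forall>v \<in> verts G. is_tree (induced T {t \<in> verts T. v \<in> B t})) \<and>
     (\<forall>e \<in> edges G. \<exists>t \<in> verts T. e \<subseteq> B t)"

definition part :: "'a graph \<Rightarrow> ('t \<Rightarrow> 'a set) \<Rightarrow> 't \<Rightarrow> 'a graph" where
  "part G B t = induced G (B t)"

definition adhesion_sets :: "'t graph \<Rightarrow> ('t \<Rightarrow> 'a set) \<Rightarrow> 'a set set" where
  "adhesion_sets T B = {B s \<inter> B t | s t. {s, t} \<in> edges T}"

text \<open>A decomposition whose tree is a single node has no adhesion sets; its adhesion is 0.\<close>

definition adhesion :: "'t graph \<Rightarrow> ('t \<Rightarrow> 'a set) \<Rightarrow> nat" where
  "adhesion T B = Max (insert 0 (card ` adhesion_sets T B))"


section \<open>Trigraphs and twin-width\<close>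

record 'a trigraph =
  tverts :: "'a set"
  black :: "'a set set"
  red :: "'a set set"

definition wf_trigraph :: "'a trigraph \<Rightarrow> bool" where
  "wf_trigraph H \<longleftrightarrow> finite (tverts H) \<and> black H \<subseteq> pairs (tverts H) \<and>
     red H \<subseteq> pairs (tverts H) \<and> black H \<inter> red H = {}"

definition trigraph_of :: "'a graph \<Rightarrow> 'a trigraph" where
  "trigraph_of G = \<lparr>tverts = verts G, black = edges G, red = {}\<rparr>"

text \<open>The contraction of \<open>x\<close> and \<open>y\<close>; the new vertex reuses the name \<open>x\<close>.\<close>

definition contract :: "'a trigraph \<Rightarrow> 'a \<Rightarrow> 'a \<Rightarrow> 'a trigraph" where
  "contract H x y =
     (let W = tverts H - {x, y};
          N = {w \<in> W. {x, w} \<in> black H \<union> red H \<or> {y, w} \<in> black H \<union> red H};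
          C = {w \<in> W. {x, w} \<in> black H \<and> {y, w} \<in> black H}
      in \<lparr>tverts = insert x W,
          black = {e \<in> black H. x \<notin> e \<and> y \<notin> e} \<union> {{x, w} | w. w \<in> C},
          red = {e \<in> red H. x \<notin> e \<and> y \<notin> e} \<union> {{x, w} | w. w \<in> N - C}\<rparr>)"

definition red_degree :: "'a trigraph \<Rightarrow> 'a \<Rightarrow> nat" where
  "red_degree H v = card {w \<in> tverts H. {v, w} \<in> red H}"

definition max_red_degree :: "'a trigraph \<Rightarrow> nat" where
  "max_red_degree H = Max (insert 0 (red_degree H ` tverts H))"

text \<open>
  The list of trigraphs occurring in a contraction sequence, including the initial one. The final
  trigraph has exactly one vertex, except that the trigraph without vertices is its own
  contraction sequence (empty bags give rise to it), so its twin-width is 0.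
\<close>

definition contraction_sequence :: "'a trigraph list \<Rightarrow> bool" where
  "contraction_sequence Hs \<longleftrightarrow> Hs \<noteq> [] \<and>
     (\<forall>i. Suc i < length Hs \<longrightarrow>
        (\<exists>x \<in> tverts (Hs ! i). \<exists>y \<in> tverts (Hs ! i).
           x \<noteq> y \<and> Hs ! Suc i = contract (Hs ! i) x y)) \<and>
     card (tverts (last Hs)) \<le> 1"

definition width :: "'a trigraph list \<Rightarrow> nat" where
  "width Hs = Max (max_red_degree ` set Hs)"

definition tww :: "'a trigraph \<Rightarrow> nat" where
  "tww H = (LEAST d. \<exists>Hs. contraction_sequence Hs \<and> hd Hs = H \<and> width Hs = d)"


section \<open>The trigraphs obtained from a part\<close>

text \<open>
  Here \<open>\<S>\<close> is the set of all adhesion sets of the decomposition. In \<open>hat_trigraph\<close>, \<open>Inl\<close> embeds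
  the old vertices and \<open>Inr S\<close> is the new vertex for \<open>S\<close>. In \<open>bar_trigraph\<close>, an edge inside an
  adhesion set that was black turns red.
\<close>

definition hat_trigraph :: "'a graph \<Rightarrow> 'a set set \<Rightarrow> ('a + 'a set) trigraph" where
  "hat_trigraph P \<S> =
     \<lparr>tverts = Inl ` verts P \<union> Inr ` {S \<in> \<S>. S \<subseteq> verts P},
      black = (\<lambda>e. Inl ` e) ` edges P,
      red = {{Inl s, Inr S} | s S. S \<in> \<S> \<and> S \<subseteq> verts P \<and> s \<in> S}\<rparr>"

definition bar_trigraph :: "'a graph \<Rightarrow> 'a set set \<Rightarrow> 'a trigraph" where
  "bar_trigraph P \<S> =
     (let R = {{u, v} | u v S. S \<in> \<S> \<and> S \<subseteq> verts P \<and> u \<in> S \<and> v \<in> S \<and> u \<noteq> v}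
      in \<lparr>tverts = verts P, black = edges P - R, red = R\<rparr>)"


section \<open>Well-definedness\<close>

lemma wf_trigraph_of: "simple_graph G \<Longrightarrow> wf_trigraph (trigraph_of G)"
  by (auto simp: simple_graph_def wf_trigraph_def trigraph_of_def)

lemma pairs_mono_iff: "e \<in> pairs V \<Longrightarrow> e \<in> pairs W \<longleftrightarrow> e \<subseteq> W"
  unfolding pairs_def by blast

lemma simple_graph_induced:
  assumes "simple_graph G"
  shows "simple_graph (induced G U)"
proof -
  have "e \<in> pairs (verts G \<inter> U)" if "e \<in> edges G" "e \<subseteq> U" for e
  proof -
    have "e \<in> pairs (verts G)" using that assms by (auto simp: simple_graph_def)
    moreover from this have "e \<subseteq> verts G" unfolding pairs_def by blast
    ultimately show ?thesis using that by (simp add: pairs_mono_iff)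
  qed
  then show ?thesis using assms by (auto simp: simple_graph_def induced_def)
qed

lemma wf_hat_trigraph:
  assumes "simple_graph P"
  shows "wf_trigraph (hat_trigraph P \<S>)"
proof -
  let ?V = "tverts (hat_trigraph P \<S>)"
  have "finite {S \<in> \<S>. S \<subseteq> verts P}"
    using assms by (auto simp: simple_graph_def intro: finite_subset[of _ "Pow (verts P)"])
  moreover have "Inl ` e \<in> pairs ?V" if "e \<in> edges P" for e
  proof -
    have "e \<in> pairs (verts P)" using that assms by (auto simp: simple_graph_def)
    then obtain u v where "e = {u, v}" "u \<in> verts P" "v \<in> verts P" "u \<noteq> v"
      unfolding pairs_def by blast
    moreover have "Inl u \<in> ?V" "Inl v \<in> ?V"
      using calculation by (auto simp: hat_trigraph_def)
    moreover have "Inl ` e = {Inl u, Inl v}" using calculation by simp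
    moreover have "(Inl u :: 'a + 'a set) \<noteq> Inl v" using calculation by simp
    ultimately show ?thesis unfolding pairs_def by blast
  qed
  moreover have "{Inl s, Inr S} \<in> pairs ?V" if "S \<in> \<S>" "S \<subseteq> verts P" "s \<in> S" for s S
  proof -
    have "Inl s \<in> ?V" "Inr S \<in> ?V" using that by (auto simp: hat_trigraph_def)
    then show ?thesis unfolding pairs_def by blast
  qed
  moreover have "black (hat_trigraph P \<S>) \<inter> red (hat_trigraph P \<S>) = {}"
  proof -
    have "Inl ` e \<noteq> {Inl s, Inr S}" for e and s :: 'a and S :: "'a set" by blast
    then show ?thesis unfolding hat_trigraph_def by (simp add: disjoint_iff) blast
  qed
  ultimately show ?thesis
    using assms unfolding simple_graph_def wf_trigraph_def
    by (auto simp: hat_trigraph_def)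
qed

lemma wf_bar_trigraph:
  assumes "simple_graph P"
  shows "wf_trigraph (bar_trigraph P \<S>)"
proof -
  have "red (bar_trigraph P \<S>) \<subseteq> pairs (verts P)"
    unfolding bar_trigraph_def Let_def pairs_def by simp blast
  then show ?thesis
    using assms unfolding simple_graph_def wf_trigraph_def bar_trigraph_def Let_def by auto
qed

lemma wf_contract:
  assumes "wf_trigraph H" "x \<in> tverts H" "y \<in> tverts H" "x \<noteq> y"
  shows "wf_trigraph (contract H x y)"
proof -
  have old: "e \<in> pairs (insert x (tverts H - {x, y}))"
    if "e \<in> pairs (tverts H)" "x \<notin> e" "y \<notin> e" for e
    using that unfolding pairs_def by blast
  have new: "{x, w} \<in> pairs (insert x (tverts H - {x, y}))" if "w \<in> tverts H - {x, y}" for w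
    using that unfolding pairs_def by blast
  have "black (contract H x y) \<subseteq> pairs (tverts (contract H x y))"
    using assms(1) old new unfolding wf_trigraph_def contract_def Let_def by (simp, blast)
  moreover have "red (contract H x y) \<subseteq> pairs (tverts (contract H x y))"
    using assms(1) old new unfolding wf_trigraph_def contract_def Let_def by (simp, blast)
  moreover have "black (contract H x y) \<inter> red (contract H x y) = {}"
    using assms(1) unfolding wf_trigraph_def contract_def Let_def
    by (simp add: set_eq_iff) (metis doubleton_eq_iff)
  ultimately show ?thesis
    using assms(1) by (simp add: wf_trigraph_def contract_def Let_def)
qed

lemma contraction_sequence_exists:
  assumes "finite (tverts H)"
  shows "\<exists>Hs. contraction_sequence Hs \<and> hd Hs = H"
  using assms
proof (induction "card (tverts H)" arbitrary: H rule: less_induct)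
  case less
  show ?case
  proof (cases "card (tverts H) \<le> 1")
    case True
    then have "contraction_sequence [H]" by (simp add: contraction_sequence_def)
    then show ?thesis by (metis list.sel(1))
  next
    case False
    then obtain x y where xy: "x \<in> tverts H" "y \<in> tverts H" "x \<noteq> y"
      using less.prems by (metis One_nat_def card_le_Suc0_iff_eq)
    have v: "tverts (contract H x y) = tverts H - {y}"
      using xy by (auto simp: contract_def Let_def)
    have "card (tverts (contract H x y)) < card (tverts H)"
      unfolding v using xy less.prems by (intro card_Diff1_less)
    then obtain Hs where Hs: "contraction_sequence Hs" "hd Hs = contract H x y"
      using less.hyps[of "contract H x y"] less.prems v by auto
    have "contraction_sequence (H # Hs)"
      unfolding contraction_sequence_def
    proof (intro conjI allI impI)
      fix i assume "Suc i < length (H # Hs)"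
      then show "\<exists>a \<in> tverts ((H # Hs) ! i). \<exists>b \<in> tverts ((H # Hs) ! i).
           a \<noteq> b \<and> (H # Hs) ! Suc i = contract ((H # Hs) ! i) a b"
        using Hs xy by (cases i) (auto simp: contraction_sequence_def hd_conv_nth)
    qed (use Hs in \<open>auto simp: contraction_sequence_def\<close>)
    then show ?thesis by (metis list.sel(1))
  qed
qed

end

theory Submission
  imports Defs
begin

text \<open>
  A contraction sequence of \<open>G\<close> is a sequence of vertex partitions, two parts being joined by a red
  edge iff they are mixed (neither completely adjacent nor completely non-adjacent). Root the tree
  and process it bottom-up. Once a node \<open>t\<close> is processed, the vertices occurring only below \<open>t\<close> are
  merged into at most \<open>2 ^ k\<close> parts, one for each neighbourhood in the adhesion set towards the
  parent; such parts are homogeneous to everything outside.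

  To process \<open>t\<close>, follow a contraction sequence of a trigraph \<open>H\<close> of width \<open>w\<close>, where each vertex of
  \<open>H\<close> stands for a bundle of at most \<open>m\<close> parts, distinguished by their types; mixed parts lie in
  the same bundle or in bundles joined by a red edge, which gives the bound \<open>m * (w + 2)\<close>.
  For the first claim, \<open>H\<close> is the hatted part, what hangs below a child with adhesion set \<open>S\<close> is
  bundled at \<open>Inr S\<close>, and \<open>m = 2 ^ k\<close>. For the second claim, \<open>H\<close> is the part with red cliques on
  the adhesion sets, what hangs below the child is bundled at an arbitrary vertex of \<open>S\<close>, but kept
  apart from the vertices of the bag, so \<open>m = 2 * 2 ^ k\<close>. This yields a bound linear in \<open>w\<close>, and
  \<open>w ^ (k - 1)\<close> dominates it because \<open>k - 1 \<ge> 2\<close>.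
\<close>

section \<open>Merging the parts of a vertex partition\<close>

definition mixed :: "'a graph \<Rightarrow> 'a set \<Rightarrow> 'a set \<Rightarrow> bool" where
  "mixed G A B \<longleftrightarrow>
     (\<exists>a\<in>A. \<exists>b\<in>B. {a, b} \<in> edges G) \<and> (\<exists>a\<in>A. \<exists>b\<in>B. {a, b} \<notin> edges G)"

definition mixed_bounded :: "'a graph \<Rightarrow> nat \<Rightarrow> 'a set set \<Rightarrow> bool" where
  "mixed_bounded G d P \<longleftrightarrow> (\<forall>A\<in>P. card {B \<in> P. B \<noteq> A \<and> mixed G A B} \<le> d)"

text \<open>The bound is imposed on every partition passed through, both ends included, so that
  chains compose and control all trigraphs of a contraction sequence.\<close>

inductive merge_chain :: "'a graph \<Rightarrow> nat \<Rightarrow> 'a set set \<Rightarrow> 'a set set \<Rightarrow> bool" for G d where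
  refl: "mixed_bounded G d P \<Longrightarrow> merge_chain G d P P"
| step: "\<lbrakk>mixed_bounded G d P; A \<in> P; B \<in> P; A \<noteq> B;
          merge_chain G d (insert (A \<union> B) (P - {A, B})) Q\<rbrakk> \<Longrightarrow> merge_chain G d P Q"

definition singletons :: "'a set \<Rightarrow> 'a set set" where
  "singletons U = (\<lambda>a. {a}) ` U"

text \<open>Indexing by attained values only keeps the empty set out of the partition.\<close>

definition fibres :: "('a \<Rightarrow> 'l) \<Rightarrow> 'a set \<Rightarrow> 'a set set" where
  "fibres f U = (\<lambda>l. {a \<in> U. f a = l}) ` f ` U"

lemma mixed_sym: "mixed G A B \<longleftrightarrow> mixed G B A"
proof -
  have "{a, b} \<in> edges G \<longleftrightarrow> {b, a} \<in> edges G" for a b by (simp add: insert_commute)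
  then show ?thesis unfolding mixed_def by meson
qed

lemma mixed_mono: "mixed G A B \<Longrightarrow> A \<subseteq> A' \<Longrightarrow> B \<subseteq> B' \<Longrightarrow> mixed G A' B'"
  unfolding mixed_def by blast

lemma not_mixed_singletons: "\<not> mixed G {a} {b}"
  by (simp add: mixed_def)

lemma mixed_bounded_subset:
  assumes "mixed_bounded G d P" "finite P" "R \<subseteq> P"
  shows "mixed_bounded G d R"
  unfolding mixed_bounded_def
proof
  fix A assume "A \<in> R"
  have "card {B \<in> R. B \<noteq> A \<and> mixed G A B} \<le> card {B \<in> P. B \<noteq> A \<and> mixed G A B}"
    using assms by (intro card_mono) auto
  then show "card {B \<in> R. B \<noteq> A \<and> mixed G A B} \<le> d"
    using assms(1,3) \<open>A \<in> R\<close> unfolding mixed_bounded_def by (meson order_trans subsetD)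
qed

lemma mixed_bounded_singletons: "mixed_bounded G d (singletons U)"
  unfolding mixed_bounded_def
proof
  fix A assume "A \<in> singletons U"
  then have none: "{B \<in> singletons U. B \<noteq> A \<and> mixed G A B} = {}"
    by (auto simp: singletons_def not_mixed_singletons)
  show "card {B \<in> singletons U. B \<noteq> A \<and> mixed G A B} \<le> d" unfolding none by simp
qed

lemma Union_singletons [simp]: "\<Union> (singletons U) = U"
  by (auto simp: singletons_def)

lemma Union_fibres [simp]: "\<Union> (fibres f U) = U"
  by (auto simp: fibres_def)

lemma empty_notin_singletons [simp]: "{} \<notin> singletons U"
  by (auto simp: singletons_def)

lemma empty_notin_fibres [simp]: "{} \<notin> fibres f U"
  by (auto simp: fibres_def)

lemma finite_singletons [simp]: "finite U \<Longrightarrow> finite (singletons U)"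
  by (simp add: singletons_def)

lemma finite_fibres [simp]: "finite U \<Longrightarrow> finite (fibres f U)"
  by (simp add: fibres_def)

lemma card_fibres_le: "finite U \<Longrightarrow> card (fibres f U) \<le> card (f ` U)"
  unfolding fibres_def by (intro card_image_le) auto

lemma fibres_inj: "inj_on f U \<Longrightarrow> fibres f U = singletons U"
proof -
  assume i: "inj_on f U"
  then have "\<And>a. a \<in> U \<Longrightarrow> {b \<in> U. f b = f a} = {a}" by (auto simp: inj_on_def)
  then show ?thesis unfolding fibres_def singletons_def image_image by (intro image_cong) auto
qed

section \<open>Composing, extending and constructing merge chains\<close>

lemma merge_chain_bounded: "merge_chain G d P Q \<Longrightarrow> mixed_bounded G d Q"
  by (induction rule: merge_chain.induct)

lemma merge_chain_trans:
  "merge_chain G d P Q \<Longrightarrow> merge_chain G d Q R \<Longrightarrow> merge_chain G d P R"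
  by (induction rule: merge_chain.induct) (auto intro: merge_chain.intros)

lemma merge_chain_refines: "merge_chain G d P Q \<Longrightarrow> A \<in> P \<Longrightarrow> \<exists>A'\<in>Q. A \<subseteq> A'"
proof (induction arbitrary: A rule: merge_chain.induct)
  case (step P B C Q)
  have "\<exists>A'\<in>insert (B \<union> C) (P - {B, C}). A \<subseteq> A'" using step.prems by auto
  then show ?case using step.IH by (meson order_trans)
qed auto

text \<open>Parts only grow along a chain and \<open>mixed\<close> is monotone, so separation of
  \<open>R\<close> from the last partition forces separation from all earlier ones, and each side
  keeps its own bound. The disjoint unions and \<open>{} \<notin> R\<close> ensure that a merge
  removes no part of \<open>R\<close>.\<close>

lemma merge_chain_Un:
  assumes "merge_chain G d P Q" "mixed_bounded G d R"
    and "\<And>A B. A \<in> Q \<Longrightarrow> B \<in> R \<Longrightarrow> \<not> mixed G A B"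
    and "\<Union> P \<inter> \<Union> R = {}" "{} \<notin> R"
  shows "merge_chain G d (P \<union> R) (Q \<union> R)"
proof -
  have bounded: "mixed_bounded G d (P \<union> R)"
    if "mixed_bounded G d P" and sep: "\<And>A B. A \<in> P \<Longrightarrow> B \<in> R \<Longrightarrow> \<not> mixed G A B" for P
    unfolding mixed_bounded_def
  proof
    fix A assume A: "A \<in> P \<union> R"
    have "A \<in> P \<Longrightarrow> {B \<in> P \<union> R. B \<noteq> A \<and> mixed G A B} = {B \<in> P. B \<noteq> A \<and> mixed G A B}"
      using sep by blast
    moreover have "A \<in> R \<Longrightarrow> {B \<in> P \<union> R. B \<noteq> A \<and> mixed G A B} = {B \<in> R. B \<noteq> A \<and> mixed G A B}"
      using sep mixed_sym by blast
    ultimately show "card {B \<in> P \<union> R. B \<noteq> A \<and> mixed G A B} \<le> d"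
      using A that(1) assms(2) unfolding mixed_bounded_def by (metis (lifting) UnE)
  qed
  show ?thesis using assms
  proof (induction rule: merge_chain.induct)
    case (refl P)
    then show ?case by (intro merge_chain.refl bounded) auto
  next
    case (step P A B Q)
    have sep: "\<not> mixed G X Y" if "X \<in> P" "Y \<in> R" for X Y
    proof -
      have "merge_chain G d P Q" by (rule merge_chain.step[OF step.hyps(1-5)])
      then obtain X' where "X' \<in> Q" "X \<subseteq> X'" using merge_chain_refines \<open>X \<in> P\<close> by blast
      then show ?thesis using step.prems(2) \<open>Y \<in> R\<close> mixed_mono by blast
    qed
    have "X \<notin> R" if "X \<in> P" for X
    proof
      assume "X \<in> R"
      then have "X \<subseteq> \<Union> P \<inter> \<Union> R" using that by blast
      then show False using step.prems(3,4) \<open>X \<in> R\<close> by simp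
    qed
    then have "A \<notin> R" "B \<notin> R" using step.hyps(2,3) by auto
    then have eq: "insert (A \<union> B) (P - {A, B}) \<union> R = insert (A \<union> B) (P \<union> R - {A, B})" by auto
    have "merge_chain G d (insert (A \<union> B) (P - {A, B}) \<union> R) (Q \<union> R)"
      using step.prems step.hyps(2,3) by (intro step.IH) auto
    then show ?case
      unfolding eq using step.hyps
      by (intro merge_chain.step[of _ _ "P \<union> R" A B] bounded[OF step.hyps(1) sep]) simp_all
  qed
qed

text \<open>Pairs of parts inside one fibre of \<open>g\<close> are merged in arbitrary order until
  none is left. \<open>near\<close> overestimates which fibres are mixed, so a part can be mixed
  only with parts in the same or a near fibre. At most \<open>d\<close> such parts exist initially,
  and merging never increases their number.\<close>

lemma merge_chain_coarsen:
  assumes "finite P" "{} \<notin> P" "\<Union> P = U"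
    and const: "\<And>C a b. C \<in> P \<Longrightarrow> a \<in> C \<Longrightarrow> b \<in> C \<Longrightarrow> g a = g b"
    and homog: "\<And>a b. a \<in> U \<Longrightarrow> b \<in> U \<Longrightarrow> g a \<noteq> g b \<Longrightarrow> \<not> near (g a) (g b) \<Longrightarrow>
       \<not> mixed G {c \<in> U. g c = g a} {c \<in> U. g c = g b}"
    and count: "\<And>a. a \<in> U \<Longrightarrow> card {C \<in> P. \<exists>b\<in>C. g b = g a \<or> near (g a) (g b)} \<le> d"
  shows "merge_chain G d P (fibres g U)"
  using assms(1,2,3) const count
proof (induction "card P" arbitrary: P rule: less_induct)
  case less
  have bounded: "mixed_bounded G d P"
    unfolding mixed_bounded_def
  proof
    fix A assume A: "A \<in> P"
    then obtain a where a: "a \<in> A" "a \<in> U"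
      using less.prems(2,3) by (metis UnionI all_not_in_conv)
    have "{B \<in> P. B \<noteq> A \<and> mixed G A B} \<subseteq> {C \<in> P. \<exists>b\<in>C. g b = g a \<or> near (g a) (g b)}"
    proof
      fix B assume "B \<in> {B \<in> P. B \<noteq> A \<and> mixed G A B}"
      then have B: "B \<in> P" "mixed G A B" by auto
      then obtain b where b: "b \<in> B" "b \<in> U"
        using less.prems(2,3) by (metis UnionI all_not_in_conv)
      have "X \<subseteq> {c \<in> U. g c = g x}" if "X \<in> P" "x \<in> X" for X x
        using less.prems(3) less.prems(4)[OF that(1) _ that(2)] that(1) by blast
      then have "A \<subseteq> {c \<in> U. g c = g a}" "B \<subseteq> {c \<in> U. g c = g b}"
        using A B(1) a(1) b(1) by blast+
      then have "mixed G {c \<in> U. g c = g a} {c \<in> U. g c = g b}" using B mixed_mono by blast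
      then have "g a = g b \<or> near (g a) (g b)" using homog[OF a(2) b(2)] by blast
      then show "B \<in> {C \<in> P. \<exists>b\<in>C. g b = g a \<or> near (g a) (g b)}" using B(1) b(1) by auto
    qed
    then have "card {B \<in> P. B \<noteq> A \<and> mixed G A B}
        \<le> card {C \<in> P. \<exists>b\<in>C. g b = g a \<or> near (g a) (g b)}"
      using less.prems(1) by (intro card_mono) auto
    then show "card {B \<in> P. B \<noteq> A \<and> mixed G A B} \<le> d" using less.prems(5)[OF a(2)] by linarith
  qed
  show ?case
  proof (cases "\<exists>C\<in>P. \<exists>D\<in>P. C \<noteq> D \<and> (\<exists>a\<in>C. \<exists>b\<in>D. g a = g b)")
    \<comment> \<open>No two parts share a value of \<open>g\<close>, so every part is already a
      whole fibre.\<close>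
    case False
    have fib: "C = {c \<in> U. g c = g a}" if "C \<in> P" "a \<in> C" for C a
    proof -
      have "c \<in> C" if "c \<in> U" "g c = g a" for c
        using that False \<open>C \<in> P\<close> \<open>a \<in> C\<close> less.prems(3) by (metis UnionE)
      then show ?thesis using that less.prems(3,4) by blast
    qed
    have "P = fibres g U"
    proof (intro set_eqI iffI)
      fix C assume "C \<in> P"
      then obtain c where "c \<in> C" "c \<in> U"
        using less.prems(2,3) by (metis UnionI all_not_in_conv)
      then have "C = (\<lambda>l. {a \<in> U. g a = l}) (g c)" using fib[OF \<open>C \<in> P\<close>] by simp
      then show "C \<in> fibres g U" using \<open>c \<in> U\<close> unfolding fibres_def by blast
    next
      fix C assume "C \<in> fibres g U"
      then obtain a where "a \<in> U" "C = {c \<in> U. g c = g a}" by (auto simp: fibres_def)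
      then show "C \<in> P" using fib less.prems(3) by blast
    qed
    then show ?thesis using bounded merge_chain.refl by metis
  next
    case True
    then obtain C D a b where CD: "C \<in> P" "D \<in> P" "C \<noteq> D" "a \<in> C" "b \<in> D" "g a = g b" by blast
    let ?P = "insert (C \<union> D) (P - {C, D})"
    have gCD: "g x = g a" if "x \<in> C \<union> D" for x
      using that less.prems(4)[OF CD(1) _ CD(4)] less.prems(4)[OF CD(2) _ CD(5)] CD(6) by auto
    \<comment> \<open>Stated for an arbitrary family because it is applied both to \<open>P\<close>
      and to the selected parts \<open>sel P\<close>.\<close>
    have cardP: "card (Q - {C, D}) + 2 = card Q" if "C \<in> Q" "D \<in> Q" "finite Q" for Q
    proof -
      have "card {C, D} \<le> card Q" using that by (intro card_mono) auto
      then show ?thesis using that CD(3) by (simp add: card_Diff_subset)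
    qed
    have "card ?P \<le> Suc (card (P - {C, D}))" by (simp add: card_insert_if less.prems(1))
    then have less': "card ?P < card P" using cardP[OF CD(1,2) less.prems(1)] by linarith
    have "merge_chain G d ?P (fibres g U)"
    proof (rule less.hyps[OF less'])
      show "finite ?P" "{} \<notin> ?P" "\<Union> ?P = U" using less.prems(1,2,3) CD(1,2) by auto
      show "g x = g y" if "X \<in> ?P" "x \<in> X" "y \<in> X" for X x y
        using that gCD[of x] gCD[of y] less.prems(4)[of X x y] by auto
      fix u assume u: "u \<in> U"
      define sel where "sel Q = {X \<in> Q. \<exists>b\<in>X. g b = g u \<or> near (g u) (g b)}" for Q
      have fin: "finite (sel P)" using less.prems(1) by (simp add: sel_def)
      \<comment> \<open>If the fibre containing \<open>C\<close> and \<open>D\<close> is selected,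
        both were counted and a single part replaces them; otherwise the merged part is not
        counted.\<close>
      have "card (sel ?P) \<le> card (sel P)"
      proof (cases "g a = g u \<or> near (g u) (g a)")
        case True
        then have "g b = g u \<or> near (g u) (g b)" using CD(6) by simp
        then have "C \<in> sel P" "D \<in> sel P" using True CD(1,2,4,5) unfolding sel_def by blast+
        then have "card (sel P - {C, D}) + 2 = card (sel P)" using cardP fin by blast
        moreover have "card (sel ?P) \<le> card (insert (C \<union> D) (sel P - {C, D}))"
          using fin by (intro card_mono) (auto simp: sel_def)
        moreover have "\<dots> \<le> Suc (card (sel P - {C, D}))" using fin by (simp add: card_insert_if)
        ultimately show ?thesis by linarith
      next
        case False
        have "C \<union> D \<notin> sel ?P"
        proof
          assume "C \<union> D \<in> sel ?P"
          then obtain x where x: "x \<in> C \<union> D" "g x = g u \<or> near (g u) (g x)"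
            unfolding sel_def by blast
          then show False using False gCD[OF x(1)] by simp
        qed
        then have "sel ?P \<subseteq> sel P" unfolding sel_def by auto
        then show ?thesis using fin card_mono by blast
      qed
      then show "card {X \<in> ?P. \<exists>b\<in>X. g b = g u \<or> near (g u) (g b)} \<le> d"
        using less.prems(5)[OF u] unfolding sel_def by linarith
    qed
    then show ?thesis by (rule merge_chain.step[OF bounded CD(1-3)])
  qed
qed

section \<open>Partitions and trigraphs\<close>

text \<open>Nonempty disjoint parts make \<open>f\<close> injective and let complete adjacency be
  told from non-adjacency. Red loops are excluded because \<open>red_degree\<close> would count
  them.\<close>

definition represents :: "'a graph \<Rightarrow> 'a trigraph \<Rightarrow> 'a set set \<Rightarrow> ('a \<Rightarrow> 'a set) \<Rightarrow> bool" where
  "represents G H P f \<longleftrightarrow> finite (tverts H) \<and> P = f ` tverts H \<and>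
     (\<forall>u\<in>tverts H. f u \<noteq> {}) \<and>
     (\<forall>u\<in>tverts H. \<forall>v\<in>tverts H. u \<noteq> v \<longrightarrow> f u \<inter> f v = {} \<and>
        ({u, v} \<in> black H \<longleftrightarrow> (\<forall>a\<in>f u. \<forall>b\<in>f v. {a, b} \<in> edges G)) \<and>
        ({u, v} \<in> red H \<longleftrightarrow> mixed G (f u) (f v))) \<and>
     (\<forall>u. {u, u} \<notin> red H)"

lemma red_degree_represents:
  assumes "represents G H P f" "mixed_bounded G d P" "v \<in> tverts H"
  shows "red_degree H v \<le> d"
proof -
  have inj: "inj_on f (tverts H)"
    using assms(1) unfolding represents_def inj_on_def by blast
  have "f ` {w \<in> tverts H. {v, w} \<in> red H} \<subseteq> {B \<in> P. B \<noteq> f v \<and> mixed G (f v) B}"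
  proof
    fix B assume "B \<in> f ` {w \<in> tverts H. {v, w} \<in> red H}"
    then obtain w where w: "w \<in> tverts H" "{v, w} \<in> red H" "B = f w" by blast
    moreover have "w \<noteq> v" using w(2) assms(1) unfolding represents_def by blast
    ultimately show "B \<in> {B \<in> P. B \<noteq> f v \<and> mixed G (f v) B}"
      using assms(1,3) inj unfolding represents_def by (auto dest: inj_onD)
  qed
  moreover have "finite P" using assms(1) by (auto simp: represents_def)
  ultimately have "card (f ` {w \<in> tverts H. {v, w} \<in> red H}) \<le> card {B \<in> P. B \<noteq> f v \<and> mixed G (f v) B}"
    by (intro card_mono) auto
  moreover have "card (f ` {w \<in> tverts H. {v, w} \<in> red H}) = red_degree H v"
    unfolding red_degree_def by (intro card_image inj_on_subset[OF inj]) auto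
  moreover have "f v \<in> P" using assms(1,3) by (auto simp: represents_def)
  ultimately show ?thesis using assms(2) unfolding mixed_bounded_def by fastforce
qed

lemma max_red_degree_represents:
  assumes "represents G H P f" "mixed_bounded G d P"
  shows "max_red_degree H \<le> d"
proof -
  have "finite (tverts H)" using assms by (simp add: represents_def)
  then show ?thesis
    unfolding max_red_degree_def using red_degree_represents[OF assms] by simp
qed

lemma contract_edges:
  assumes "w \<in> tverts H - {x, y}"
  shows "{x, w} \<in> black (contract H x y) \<longleftrightarrow> {x, w} \<in> black H \<and> {y, w} \<in> black H"
    and "{x, w} \<in> red (contract H x y) \<longleftrightarrow>
      ({x, w} \<in> black H \<union> red H \<or> {y, w} \<in> black H \<union> red H) \<and>
      \<not> ({x, w} \<in> black H \<and> {y, w} \<in> black H)"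
  using assms unfolding contract_def Let_def by (auto simp: doubleton_eq_iff)

lemma contract_old_edges:
  assumes "u \<noteq> x" "u \<noteq> y" "w \<noteq> x" "w \<noteq> y"
  shows "{u, w} \<in> black (contract H x y) \<longleftrightarrow> {u, w} \<in> black H"
    and "{u, w} \<in> red (contract H x y) \<longleftrightarrow> {u, w} \<in> red H"
  using assms unfolding contract_def Let_def by (auto simp: doubleton_eq_iff)

lemma tverts_contract: "x \<in> tverts H \<Longrightarrow> x \<noteq> y \<Longrightarrow> tverts (contract H x y) = tverts H - {y}"
  by (auto simp: contract_def Let_def)

text \<open>The colour rule of \<open>contract\<close> is the rule for unions of parts: the union is
  complete to \<open>f w\<close> iff both parts are, it touches \<open>f w\<close> iff one of them
  does, and it is mixed iff it touches without being complete.\<close>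

lemma represents_contract:
  assumes rep: "represents G H P f" and xy: "x \<in> tverts H" "y \<in> tverts H" "x \<noteq> y"
  shows "represents G (contract H x y) (insert (f x \<union> f y) (P - {f x, f y})) (f(x := f x \<union> f y))"
proof -
  let ?H = "contract H x y" and ?f = "f(x := f x \<union> f y)"
  have tv: "tverts ?H = tverts H - {y}" using tverts_contract xy by metis
  have ne: "f u \<noteq> {}" if "u \<in> tverts H" for u using rep that by (simp add: represents_def)
  have disj: "f u \<inter> f v = {}" if "u \<in> tverts H" "v \<in> tverts H" "u \<noteq> v" for u v
    using rep that by (simp add: represents_def)
  have bl: "{u, v} \<in> black H \<longleftrightarrow> (\<forall>a\<in>f u. \<forall>b\<in>f v. {a, b} \<in> edges G)"
    if "u \<in> tverts H" "v \<in> tverts H" "u \<noteq> v" for u v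
    using rep that by (simp add: represents_def)
  have rd: "{u, v} \<in> red H \<longleftrightarrow> mixed G (f u) (f v)"
    if "u \<in> tverts H" "v \<in> tverts H" "u \<noteq> v" for u v
    using rep that by (simp add: represents_def)
  have new: "{x, w} \<in> black ?H \<longleftrightarrow> (\<forall>a\<in>f x \<union> f y. \<forall>b\<in>f w. {a, b} \<in> edges G)"
      "{x, w} \<in> red ?H \<longleftrightarrow> mixed G (f x \<union> f y) (f w)"
    if w: "w \<in> tverts H - {x, y}" for w
  proof -
    show "{x, w} \<in> black ?H \<longleftrightarrow> (\<forall>a\<in>f x \<union> f y. \<forall>b\<in>f w. {a, b} \<in> edges G)"
      using contract_edges(1)[OF w] bl xy w by blast
    \<comment> \<open>Nonemptiness of the parts turns complete adjacency into the existence of an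
      edge.\<close>
    have touch: "{u, w} \<in> black H \<union> red H \<longleftrightarrow> (\<exists>a\<in>f u. \<exists>b\<in>f w. {a, b} \<in> edges G)"
      if "u = x \<or> u = y" for u
    proof -
      have u: "u \<in> tverts H" "w \<in> tverts H" "u \<noteq> w" using w xy that by auto
      show ?thesis
        using bl[OF u] rd[OF u] ne[OF u(1)] ne[OF u(2)] unfolding mixed_def by blast
    qed
    have x: "x \<in> tverts H" "w \<in> tverts H" "x \<noteq> w" and y: "y \<in> tverts H" "w \<in> tverts H" "y \<noteq> w"
      using w xy by auto
    show "{x, w} \<in> red ?H \<longleftrightarrow> mixed G (f x \<union> f y) (f w)"
      unfolding contract_edges(2)[OF w] touch[OF disjI1[OF HOL.refl]] touch[OF disjI2[OF HOL.refl]] bl[OF x] bl[OF y] mixed_def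
      by blast
  qed
  have "f ` (tverts H - {x, y}) = P - {f x, f y}"
  proof -
    have "f u \<noteq> f v" if "u \<in> tverts H" "v \<in> tverts H" "u \<noteq> v" for u v
      using disj[OF that] ne[OF that(1)] by auto
    then have "inj_on f (tverts H)" by (auto simp: inj_on_def)
    then have "f ` (tverts H - {x, y}) = f ` tverts H - f ` {x, y}"
      using xy by (intro inj_on_image_set_diff) auto
    then show ?thesis using rep by (simp add: represents_def)
  qed
  moreover have "?f ` (tverts H - {y}) = insert (f x \<union> f y) (f ` (tverts H - {x, y}))"
    using xy by auto
  ultimately have P: "insert (f x \<union> f y) (P - {f x, f y}) = ?f ` tverts ?H" by (simp add: tv)
  have loop: "{u, u} \<notin> red ?H" for u
    using rep unfolding represents_def contract_def Let_def by auto
  have pair: "?f u \<inter> ?f v = {} \<and>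
        ({u, v} \<in> black ?H \<longleftrightarrow> (\<forall>a\<in>?f u. \<forall>b\<in>?f v. {a, b} \<in> edges G)) \<and>
        ({u, v} \<in> red ?H \<longleftrightarrow> mixed G (?f u) (?f v))"
    if uv: "u \<in> tverts ?H" "v \<in> tverts ?H" "u \<noteq> v" for u v
  proof -
    have m: "u \<in> tverts H" "v \<in> tverts H" "u \<noteq> y" "v \<noteq> y" using uv tv by auto
    consider "u = x" | "v = x" | "u \<noteq> x" "v \<noteq> x" by blast
    then show ?thesis
    proof cases
      case 1
      then have "v \<in> tverts H - {x, y}" using m uv by auto
      then show ?thesis using new[of v] disj[of x v] disj[of y v] xy 1 uv by auto
    next
      case 2
      then have u: "u \<in> tverts H - {x, y}" using m uv by auto
      have "{u, x} = {x, u}" by auto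
      moreover have "mixed G (f u) (f x \<union> f y) \<longleftrightarrow> mixed G (f x \<union> f y) (f u)" by (rule mixed_sym)
      moreover have "(\<forall>a\<in>f u. \<forall>b\<in>f x \<union> f y. {a, b} \<in> edges G)
          \<longleftrightarrow> (\<forall>a\<in>f x \<union> f y. \<forall>b\<in>f u. {a, b} \<in> edges G)"
        by (intro iffI ballI) (subst insert_commute, blast)+
      ultimately show ?thesis using new[OF u] disj[of u x] disj[of u y] m xy 2 uv(3)
        by (simp add: Int_Un_distrib)
    next
      case 3
      then show ?thesis
        using contract_old_edges[of u x y v H] m bl[of u v] rd[of u v] disj[of u v] uv(3) by simp
    qed
  qed
  have fin: "finite (tverts ?H)" using rep tv by (simp add: represents_def)
  have ne': "?f u \<noteq> {}" if "u \<in> tverts ?H" for u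
    using that ne[of u] ne[OF xy(1)] unfolding tv by simp
  show ?thesis
    unfolding represents_def
    by (intro conjI ballI allI impI)
      (rule fin P ne' loop pair[THEN conjunct1] pair[THEN conjunct2, THEN conjunct1]
         pair[THEN conjunct2, THEN conjunct2] | assumption)+
qed

text \<open>Each merge is realised by contracting the two vertices that stand for the merged parts;
  a last partition with at most one part belongs to a trigraph with at most one vertex.\<close>

lemma merge_chain_contraction_sequence:
  assumes "merge_chain G d P Q" "card Q \<le> 1" "represents G H P f"
  shows "\<exists>Hs. contraction_sequence Hs \<and> hd Hs = H \<and> (\<forall>H'\<in>set Hs. max_red_degree H' \<le> d)"
  using assms
proof (induction arbitrary: H f rule: merge_chain.induct)
  case (refl P)
  have "inj_on f (tverts H)" using refl.prems(2) unfolding represents_def inj_on_def by blast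
  then have "card (tverts H) \<le> 1"
    using refl.prems by (simp add: represents_def card_image)
  then have "contraction_sequence [H]" by (simp add: contraction_sequence_def)
  moreover have "max_red_degree H \<le> d" using max_red_degree_represents refl by blast
  ultimately show ?case by (intro exI[of _ "[H]"]) simp
next
  case (step P A B Q)
  obtain x y where xy: "x \<in> tverts H" "y \<in> tverts H" "A = f x" "B = f y"
    using step.prems(2) step.hyps(2,3) by (auto simp: represents_def)
  then have "x \<noteq> y" using step.hyps(4) by auto
  obtain Hs where Hs: "contraction_sequence Hs" "hd Hs = contract H x y"
      "\<forall>H'\<in>set Hs. max_red_degree H' \<le> d"
    using step.IH[OF step.prems(1)] represents_contract[OF step.prems(2) xy(1,2) \<open>x \<noteq> y\<close>] xy(3,4)
    by blast
  have "contraction_sequence (H # Hs)"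
    unfolding contraction_sequence_def
  proof (intro conjI allI impI)
    fix i assume "Suc i < length (H # Hs)"
    then show "\<exists>a \<in> tverts ((H # Hs) ! i). \<exists>b \<in> tverts ((H # Hs) ! i).
         a \<noteq> b \<and> (H # Hs) ! Suc i = contract ((H # Hs) ! i) a b"
      using Hs(1,2) xy(1,2) \<open>x \<noteq> y\<close> by (cases i) (auto simp: contraction_sequence_def hd_conv_nth)
  qed (use Hs in \<open>auto simp: contraction_sequence_def\<close>)
  moreover have "max_red_degree H \<le> d"
    using max_red_degree_represents step.prems(2) step.hyps(1) by blast
  ultimately show ?case using Hs by (intro exI[of _ "H # Hs"]) simp
qed

section \<open>Bounds and witnesses for twin-width\<close>

lemma tww_le:
  assumes "contraction_sequence Hs" "hd Hs = H" "\<And>H'. H' \<in> set Hs \<Longrightarrow> max_red_degree H' \<le> d"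
  shows "tww H \<le> d"
proof -
  have "tww H \<le> width Hs" unfolding tww_def by (rule Least_le) (use assms in blast)
  also have "\<dots> \<le> d"
    using assms(1,3) unfolding width_def contraction_sequence_def by (subst Max_le_iff) auto
  finally show ?thesis .
qed

lemma tww_witness:
  assumes "finite (tverts H)"
  obtains Hs where "contraction_sequence Hs" "hd Hs = H"
    "\<And>H'. H' \<in> set Hs \<Longrightarrow> max_red_degree H' \<le> tww H"
proof -
  have "\<exists>d Hs. contraction_sequence Hs \<and> hd Hs = H \<and> width Hs = d"
    using contraction_sequence_exists[OF assms] by blast
  then obtain Hs where Hs: "contraction_sequence Hs" "hd Hs = H" "width Hs = tww H"
    using LeastI_ex[of "\<lambda>d. \<exists>Hs. contraction_sequence Hs \<and> hd Hs = H \<and> width Hs = d"]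
    unfolding tww_def by blast
  moreover have "max_red_degree H' \<le> tww H" if "H' \<in> set Hs" for H'
    using that Hs(3) unfolding width_def by (metis List.finite_set Max_ge finite_imageI imageI)
  ultimately show ?thesis using that by blast
qed

lemma tww_le_merge_chain:
  assumes "simple_graph G" "merge_chain G d (singletons (verts G)) Q" "card Q \<le> 1"
  shows "tww (trigraph_of G) \<le> d"
proof -
  have "represents G (trigraph_of G) (singletons (verts G)) (\<lambda>v. {v})"
    using assms(1) unfolding represents_def trigraph_of_def singletons_def simple_graph_def
    by (auto simp: not_mixed_singletons)
  then show ?thesis
    using merge_chain_contraction_sequence[OF assms(2,3)] tww_le by metis
qed

section \<open>Following the contractions of a trigraph\<close>

definition nbrs_in :: "'a graph \<Rightarrow> 'a set \<Rightarrow> 'a \<Rightarrow> 'a set" where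
  "nbrs_in G S a = {s \<in> S. {a, s} \<in> edges G}"

text \<open>
  Vertex \<open>a\<close> of \<open>G\<close> is bundled at vertex \<open>\<beta> a\<close> of \<open>H\<close> and has type \<open>\<tau> a\<close>. Black edges of \<open>H\<close> mean
  adjacency only for types related by \<open>\<gamma>\<close>: in the second claim they say nothing about vertices
  outside the bag.
\<close>

definition models ::
    "'a graph \<Rightarrow> 'a set \<Rightarrow> 'h trigraph \<Rightarrow> ('a \<Rightarrow> 'h) \<Rightarrow> ('a \<Rightarrow> 'c) \<Rightarrow> ('c \<Rightarrow> 'c \<Rightarrow> bool) \<Rightarrow> bool"
  where
  "models G U H \<beta> \<tau> \<gamma> \<longleftrightarrow>
     (\<forall>a\<in>U. \<forall>b\<in>U. \<beta> a \<noteq> \<beta> b \<longrightarrow> {\<beta> a, \<beta> b} \<notin> red H \<longrightarrow>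
        ({a, b} \<in> edges G \<longleftrightarrow> {\<beta> a, \<beta> b} \<in> black H \<and> \<gamma> (\<tau> a) (\<tau> b)))"

text \<open>Away from red edges, adjacency is a function of bundles and types alone, so two label
  classes are homogeneous to each other.\<close>

lemma models_not_mixed:
  assumes "models G U H \<beta> \<tau> \<gamma>" "x \<noteq> y" "{x, y} \<notin> red H"
  shows "\<not> mixed G {c \<in> U. (\<beta> c, \<tau> c) = (x, s)} {c \<in> U. (\<beta> c, \<tau> c) = (y, t)}"
proof -
  have "{a, b} \<in> edges G \<longleftrightarrow> {x, y} \<in> black H \<and> \<gamma> s t"
    if "a \<in> {c \<in> U. (\<beta> c, \<tau> c) = (x, s)}" "b \<in> {c \<in> U. (\<beta> c, \<tau> c) = (y, t)}" for a b
    using assms that unfolding models_def by auto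
  then show ?thesis unfolding mixed_def by blast
qed

text \<open>Here \<open>x\<close> ranges over all points, since a bundle may sit at an extra point
  outside \<open>H\<close>; such a point has no red neighbours.\<close>

lemma red_neighbours:
  assumes "wf_trigraph H" "max_red_degree H \<le> w"
  shows "finite {z. {x, z} \<in> red H}" "card {z. {x, z} \<in> red H} \<le> w"
proof -
  have fin: "finite (tverts H)" using assms(1) by (simp add: wf_trigraph_def)
  have sub: "x \<in> tverts H \<and> z \<in> tverts H" if "{x, z} \<in> red H" for x z
  proof -
    have "{x, z} \<in> pairs (tverts H)" using that assms(1) by (auto simp: wf_trigraph_def)
    then show ?thesis unfolding pairs_def by (auto simp: doubleton_eq_iff)
  qed
  then have "{z. {x, z} \<in> red H} \<subseteq> tverts H" by blast
  then show "finite {z. {x, z} \<in> red H}" using fin by (rule finite_subset)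
  show "card {z. {x, z} \<in> red H} \<le> w"
  proof (cases "x \<in> tverts H")
    case True
    have "{z. {x, z} \<in> red H} = {z \<in> tverts H. {x, z} \<in> red H}" using sub by blast
    then have "card {z. {x, z} \<in> red H} = red_degree H x" by (simp add: red_degree_def)
    also have "\<dots> \<le> max_red_degree H" unfolding max_red_degree_def using True fin by simp
    finally show ?thesis using assms(2) by simp
  next
    case False
    then have "{z. {x, z} \<in> red H} = {}" using sub by blast
    then show ?thesis by simp
  qed
qed

lemma card_fibres_over:
  assumes "finite U" "finite Z" "card (\<tau> ` U) \<le> m"
  shows "card {C \<in> fibres (\<lambda>a. (\<beta> a, \<tau> a)) U. \<exists>b\<in>C. \<beta> b \<in> Z} \<le> m * card Z"
proof -
  have "{C \<in> fibres (\<lambda>a. (\<beta> a, \<tau> a)) U. \<exists>b\<in>C. \<beta> b \<in> Z}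
      \<subseteq> (\<lambda>l. {a \<in> U. (\<beta> a, \<tau> a) = l}) ` (Z \<times> \<tau> ` U)"
    by (auto simp: fibres_def)
  then have "card {C \<in> fibres (\<lambda>a. (\<beta> a, \<tau> a)) U. \<exists>b\<in>C. \<beta> b \<in> Z}
      \<le> card ((\<lambda>l. {a \<in> U. (\<beta> a, \<tau> a) = l}) ` (Z \<times> \<tau> ` U))"
    using assms by (intro card_mono) auto
  also have "\<dots> \<le> card (Z \<times> \<tau> ` U)" using assms by (intro card_image_le) auto
  also have "\<dots> \<le> m * card Z" using assms(3) by (simp add: card_cartesian_product mult.commute)
  finally show ?thesis .
qed

lemma contract_edge_iff:
  fixes x y :: 'a
  defines "p \<equiv> \<lambda>v. if v = y then x else v"
  assumes wf: "wf_trigraph H" and xy: "x \<in> tverts H" "y \<in> tverts H" "x \<noteq> y"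
    and ne: "p u \<noteq> p v" and nonred: "{p u, p v} \<notin> red (contract H x y)"
  shows "{u, v} \<notin> red H \<and> ({u, v} \<in> black H \<longleftrightarrow> {p u, p v} \<in> black (contract H x y))"
proof -
  let ?H = "contract H x y"
  have out: "{r, s} \<notin> black H \<and> {r, s} \<notin> red H" if "s \<notin> tverts H" for r s
  proof -
    have "{r, s} \<notin> pairs (tverts H)" using that unfolding pairs_def by (auto simp: doubleton_eq_iff)
    then show ?thesis using wf by (auto simp: wf_trigraph_def)
  qed
  have out': "{r, s} \<notin> black ?H \<and> {r, s} \<notin> red ?H" if "s \<notin> tverts H" for r s
  proof -
    have "s \<notin> tverts ?H" using that xy by (simp add: tverts_contract)
    then have "{r, s} \<notin> pairs (tverts ?H)" unfolding pairs_def by (auto simp: doubleton_eq_iff)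
    then show ?thesis using wf_contract[OF wf xy] by (auto simp: wf_trigraph_def)
  qed
  have disj: "black H \<inter> red H = {}" using wf by (simp add: wf_trigraph_def)
  have one: "{u, v} \<notin> red H \<and> ({u, v} \<in> black H \<longleftrightarrow> {x, v} \<in> black ?H)"
    if "u = x \<or> u = y" "v \<noteq> x" "v \<noteq> y" "{x, v} \<notin> red ?H" for u v
  proof (cases "v \<in> tverts H")
    case True
    then have v: "v \<in> tverts H - {x, y}" using that by simp
    show ?thesis using contract_edges[OF v] that disj by blast
  next
    case False
    then show ?thesis using out out' by blast
  qed
  consider "u = x \<or> u = y" "v \<noteq> x" "v \<noteq> y" | "v = x \<or> v = y" "u \<noteq> x" "u \<noteq> y"
    | "u \<noteq> x" "u \<noteq> y" "v \<noteq> x" "v \<noteq> y"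
    using ne unfolding p_def by (auto split: if_splits)
  then show ?thesis
  proof cases
    case 1
    then show ?thesis using one[of u v] nonred by (auto simp: p_def)
  next
    case 2
    then have "p v = x" "p u = u" by (auto simp: p_def)
    then show ?thesis using one[of v u] 2 nonred by (simp add: insert_commute)
  next
    case 3
    then show ?thesis using contract_old_edges[of u x y v H] nonred by (simp add: p_def)
  qed
qed

lemma models_contract:
  assumes "models G U H \<beta> \<tau> \<gamma>" "wf_trigraph H" "x \<in> tverts H" "y \<in> tverts H" "x \<noteq> y"
  shows "models G U (contract H x y) (\<lambda>a. if \<beta> a = y then x else \<beta> a) \<tau> \<gamma>"
  unfolding models_def
proof (intro ballI impI)
  let ?p = "\<lambda>v. if v = y then x else v"
  fix a b
  assume ab: "a \<in> U" "b \<in> U" "?p (\<beta> a) \<noteq> ?p (\<beta> b)"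
    "{?p (\<beta> a), ?p (\<beta> b)} \<notin> red (contract H x y)"
  have "\<beta> a \<noteq> \<beta> b" using ab(3) by metis
  then show "{a, b} \<in> edges G \<longleftrightarrow>
      {?p (\<beta> a), ?p (\<beta> b)} \<in> black (contract H x y) \<and> \<gamma> (\<tau> a) (\<tau> b)"
    using contract_edge_iff[OF assms(2-5) ab(3,4)] assms(1) ab(1,2) unfolding models_def by blast
qed

text \<open>
  The extra point \<open>z\<close> need not be a vertex of \<open>H\<close>: it is the value of \<open>SOME s. s \<in> S\<close> for an empty
  adhesion set \<open>S\<close>, even if the bag is empty.
\<close>

lemma merge_chain_along_contractions:
  fixes \<beta> :: "'a \<Rightarrow> 'h" and \<tau> :: "'a \<Rightarrow> 'c"
  assumes "finite U" "card (\<tau> ` U) \<le> m"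
    and "\<And>a b. a \<in> U \<Longrightarrow> b \<in> U \<Longrightarrow> \<tau> a = \<tau> b \<Longrightarrow> g a = g b"
    and "contraction_sequence Hs" "\<And>H. H \<in> set Hs \<Longrightarrow> max_red_degree H \<le> w"
    and "wf_trigraph (hd Hs)" "\<beta> ` U \<subseteq> insert z (tverts (hd Hs))" "models G U (hd Hs) \<beta> \<tau> \<gamma>"
  shows "merge_chain G (m * (w + 2)) (fibres (\<lambda>a. (\<beta> a, \<tau> a)) U) (fibres g U)"
  using assms(4-8)
proof (induction Hs arbitrary: \<beta>)
  case Nil
  then show ?case by (simp add: contraction_sequence_def)
next
  case (Cons H Hs)
  let ?P = "fibres (\<lambda>a. (\<beta> a, \<tau> a)) U"
  have constP: "\<beta> a = \<beta> b" "\<tau> a = \<tau> b" "a \<in> U" "b \<in> U" if "C \<in> ?P" "a \<in> C" "b \<in> C" for C a b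
    using that by (auto simp: fibres_def)
  have finH: "finite (tverts H)" using Cons.prems(3) by (simp add: wf_trigraph_def)
  show ?case
  proof (cases "Hs = []")
    case True
    then have small: "card (tverts H) \<le> 1" using Cons.prems(1) by (simp add: contraction_sequence_def)
    \<comment> \<open>At the end at most one vertex and the extra point \<open>z\<close> carry
      bundles, so at most \<open>2 * m\<close> parts remain and may be merged in any order.\<close>
    have "card (insert z (tverts H)) \<le> Suc (card (tverts H))" using finH by (simp add: card_insert_if)
    then have "card (insert z (tverts H)) \<le> w + 2" using small by linarith
    then have le: "m * card (insert z (tverts H)) \<le> m * (w + 2)" by (rule mult_le_mono2)
    have "C \<in> {C \<in> ?P. \<exists>b\<in>C. \<beta> b \<in> insert z (tverts H)}" if "C \<in> ?P" for C
      using that Cons.prems(4) by (auto simp: fibres_def)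
    then have "{C \<in> ?P. \<exists>b\<in>C. g b = g a \<or> True} \<subseteq> {C \<in> ?P. \<exists>b\<in>C. \<beta> b \<in> insert z (tverts H)}" for a
      by blast
    then have "card {C \<in> ?P. \<exists>b\<in>C. g b = g a \<or> True}
        \<le> card {C \<in> ?P. \<exists>b\<in>C. \<beta> b \<in> insert z (tverts H)}" for a
      using assms(1) by (intro card_mono) auto
    then have count: "card {C \<in> ?P. \<exists>b\<in>C. g b = g a \<or> True} \<le> m * (w + 2)" for a
      using card_fibres_over[OF assms(1) _ assms(2), of "insert z (tverts H)" \<beta>] finH le
      by (meson finite_insert order_trans)
    show ?thesis
    proof (rule merge_chain_coarsen[where near = "\<lambda>_ _. True"])
      show "finite ?P" "{} \<notin> ?P" "\<Union> ?P = U" using assms(1) by auto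
      show "g a = g b" if "C \<in> ?P" "a \<in> C" "b \<in> C" for C a b
        using constP[OF that] assms(3) by blast
      show "card {C \<in> ?P. \<exists>b\<in>C. g b = g a \<or> True} \<le> m * (w + 2)" for a by (rule count)
    qed simp
  next
    case False
    have "Suc 0 < length (H # Hs)" using False by simp
    then have "\<exists>x \<in> tverts H. \<exists>y \<in> tverts H. x \<noteq> y \<and> Hs ! 0 = contract H x y"
      using Cons.prems(1) unfolding contraction_sequence_def by fastforce
    then obtain x y where xy: "x \<in> tverts H" "y \<in> tverts H" "x \<noteq> y" "hd Hs = contract H x y"
      using False by (auto simp: hd_conv_nth)
    let ?b = "\<lambda>a. if \<beta> a = y then x else \<beta> a"
    have wf': "wf_trigraph (hd Hs)" using wf_contract Cons.prems(3) xy by simp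
    have "\<exists>x \<in> tverts (Hs ! i). \<exists>y \<in> tverts (Hs ! i). x \<noteq> y \<and> Hs ! Suc i = contract (Hs ! i) x y"
      if "Suc i < length Hs" for i
    proof -
      have "Suc (Suc i) < length (H # Hs)" using that by simp
      then show ?thesis using Cons.prems(1) unfolding contraction_sequence_def by fastforce
    qed
    then have seq: "contraction_sequence Hs"
      using Cons.prems(1) False unfolding contraction_sequence_def by simp
    have mod: "models G U (hd Hs) ?b \<tau> \<gamma>"
      unfolding xy(4) using Cons.prems(3,5) xy by (intro models_contract) auto
    have rng: "?b ` U \<subseteq> insert z (tverts (hd Hs))"
      using Cons.prems(4) xy by (auto simp: tverts_contract)
    have tail: "merge_chain G (m * (w + 2)) (fibres (\<lambda>a. (?b a, \<tau> a)) U) (fibres g U)"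
      using Cons.IH[OF seq _ wf' rng mod] Cons.prems(2) by simp
    \<comment> \<open>Nearness is read off after the contraction, since the fibres to be produced
      are labelled by vertices of the contracted trigraph.\<close>
    define near where "near l l' \<longleftrightarrow> fst l = fst l' \<or> {fst l, fst l'} \<in> red (hd Hs)"
      for l l' :: "'h \<times> 'c"
    have "merge_chain G (m * (w + 2)) ?P (fibres (\<lambda>a. (?b a, \<tau> a)) U)"
    proof (rule merge_chain_coarsen[where near = near])
      show "finite ?P" "{} \<notin> ?P" "\<Union> ?P = U" using assms(1) by auto
      show "(?b a, \<tau> a) = (?b b, \<tau> b)" if "C \<in> ?P" "a \<in> C" "b \<in> C" for C a b
        using constP[OF that] by simp
      show "\<not> mixed G {c \<in> U. (?b c, \<tau> c) = (?b a, \<tau> a)} {c \<in> U. (?b c, \<tau> c) = (?b b, \<tau> b)}"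
        if "\<not> near (?b a, \<tau> a) (?b b, \<tau> b)" for a b
        using that by (intro models_not_mixed[OF mod]) (auto simp: near_def)
      fix a
      \<comment> \<open>The present parts still carry the labels from before the contraction, so
        \<open>y\<close> is counted besides the vertex itself and its red neighbours; this is the
        source of \<open>w + 2\<close>.\<close>
      define Z where "Z = insert (?b a) (insert y {v. {?b a, v} \<in> red (hd Hs)})"
      have deg: "max_red_degree (hd Hs) \<le> w" using Cons.prems(2) False by simp
      have finZ: "finite Z" using red_neighbours(1)[OF wf' deg] by (simp add: Z_def)
      have "card Z \<le> Suc (Suc (card {v. {?b a, v} \<in> red (hd Hs)}))"
        using red_neighbours(1)[OF wf' deg] by (simp add: Z_def card_insert_if)
      then have cardZ: "card Z \<le> w + 2" using red_neighbours(2)[OF wf' deg, of "?b a"] by linarith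
      have "{C \<in> ?P. \<exists>b\<in>C. (?b b, \<tau> b) = (?b a, \<tau> a) \<or> near (?b a, \<tau> a) (?b b, \<tau> b)}
          \<subseteq> {C \<in> ?P. \<exists>b\<in>C. \<beta> b \<in> Z}"
        unfolding near_def Z_def by (auto split: if_splits)
      then have "card {C \<in> ?P. \<exists>b\<in>C. (?b b, \<tau> b) = (?b a, \<tau> a) \<or> near (?b a, \<tau> a) (?b b, \<tau> b)}
          \<le> card {C \<in> ?P. \<exists>b\<in>C. \<beta> b \<in> Z}"
        using assms(1) by (intro card_mono) auto
      also have "\<dots> \<le> m * card Z" by (rule card_fibres_over[OF assms(1) finZ assms(2)])
      also have "\<dots> \<le> m * (w + 2)" using cardZ by (rule mult_le_mono2)
      finally show "card {C \<in> ?P. \<exists>b\<in>C. (?b b, \<tau> b) = (?b a, \<tau> a) \<or> near (?b a, \<tau> a) (?b b, \<tau> b)}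
          \<le> m * (w + 2)" .
    qed
    then show ?thesis using tail merge_chain_trans by blast
  qed
qed

text \<open>
  Here \<open>X\<close> consists of the vertices whose topmost bag is the current one, and \<open>W i\<close> of those hanging
  below child \<open>i\<close> with adhesion set \<open>S i\<close>. The children are absorbed one at a time.
\<close>

lemma merge_chain_node:
  fixes \<beta> :: "'a \<Rightarrow> 'h" and \<tau> :: "'a \<Rightarrow> 'c" and W S :: "'i \<Rightarrow> 'a set"
  assumes finU: "finite U" and finI: "finite I" and U: "U = X \<union> (\<Union>i\<in>I. W i)"
    and disj: "\<And>i j. i \<in> I \<Longrightarrow> j \<in> I \<Longrightarrow> i \<noteq> j \<Longrightarrow> W i \<inter> W j = {}"
    and XW: "\<And>i. i \<in> I \<Longrightarrow> X \<inter> W i = {}"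
    and out: "\<And>i a b. i \<in> I \<Longrightarrow> a \<in> W i \<Longrightarrow> b \<notin> W i \<Longrightarrow> {a, b} \<in> edges G \<Longrightarrow> b \<in> S i"
    and SX: "\<And>i. i \<in> I \<Longrightarrow> S i \<inter> U \<subseteq> X"
    and chain: "\<And>i. i \<in> I \<Longrightarrow>
      merge_chain G (m * (w + 2)) (singletons (W i)) (fibres (nbrs_in G (S i)) (W i))"
    and types: "\<And>i. i \<in> I \<Longrightarrow> card (nbrs_in G (S i) ` W i) \<le> m"
    and single: "\<And>u b. u \<in> X \<Longrightarrow> b \<in> U \<Longrightarrow> \<beta> b = \<beta> u \<Longrightarrow> \<tau> b = \<tau> u \<Longrightarrow> b = u"
    and determined: "\<And>i a b. i \<in> I \<Longrightarrow> a \<in> W i \<Longrightarrow> b \<in> W i \<Longrightarrow>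
      nbrs_in G (S i) a = nbrs_in G (S i) b \<Longrightarrow> \<beta> a = \<beta> b \<and> \<tau> a = \<tau> b"
    and wf: "wf_trigraph H" and deg: "max_red_degree H \<le> w"
    and mod: "models G U H \<beta> \<tau> \<gamma>" and card\<tau>: "card (\<tau> ` U) \<le> m"
  shows "merge_chain G (m * (w + 2)) (singletons U) (fibres (\<lambda>a. (\<beta> a, \<tau> a)) U)"
proof -
  define h where "h a = (\<beta> a, \<tau> a)" for a
  let ?d = "m * (w + 2)"
  define Y where "Y D = X \<union> (\<Union>i\<in>D. W i)" for D
  \<comment> \<open>A vertex of \<open>X\<close> shares its bundle and type with no other vertex of
    \<open>U\<close>.\<close>
  have real: "B = {u}" if "B \<in> fibres h V" "V \<subseteq> U" "u \<in> B" "u \<in> X" for B V u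
    using that single unfolding fibres_def h_def by auto
  \<comment> \<open>An edge leaving \<open>W i\<close> ends in \<open>S i\<close>, whose vertices in
    \<open>U\<close> all lie in \<open>X\<close>.\<close>
  have far: "{a, b} \<notin> edges G" if "i \<in> I" "a \<in> W i" "b \<in> U" "b \<notin> W i" "b \<notin> X" for i a b
    using out[OF that(1,2,4)] SX[OF that(1)] that by blast
  \<comment> \<open>Invariant: the absorbed set \<open>Y D\<close> is grouped by \<open>h\<close>,
    and everything else is still split into singletons.\<close>
  have "merge_chain G ?d (singletons U) (fibres h (Y D) \<union> singletons (U - Y D))" if "D \<subseteq> I" for D
    using finite_subset[OF that finI] that
  proof (induction D rule: finite_induct)
    case empty
    have "inj_on h X" using single U unfolding h_def inj_on_def by auto
    then have "fibres h (Y {}) \<union> singletons (U - Y {}) = singletons (X \<union> (U - X))"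
      unfolding Y_def by (simp add: fibres_inj) (simp add: singletons_def image_Un[symmetric])
    also have "X \<union> (U - X) = U" using U by blast
    finally show ?case using merge_chain.refl[OF mixed_bounded_singletons] by metis
  next
    case (insert i D)
    have i: "i \<in> I" and D: "D \<subseteq> I" using insert.prems by auto
    define V where "V = Y (insert i D)"
    have Vi: "V = W i \<union> Y D" by (auto simp: V_def Y_def)
    have VU: "V \<subseteq> U" "Y D \<subseteq> U" "W i \<subseteq> U" using U D i unfolding V_def Y_def by auto
    have dWY: "W i \<inter> Y D = {}"
      using XW[OF i] disj[OF i] insert.hyps(2) D unfolding Y_def by blast
    have prev: "merge_chain G ?d (singletons U) (fibres h (Y D) \<union> singletons (U - Y D))"
      using insert.IH[OF D] .
    have boundR: "mixed_bounded G ?d (fibres h (Y D))"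
    proof (rule mixed_bounded_subset[OF merge_chain_bounded[OF prev]])
      show "finite (fibres h (Y D) \<union> singletons (U - Y D))"
        using finU finite_subset[OF VU(2) finU] by simp
    qed simp
    \<comment> \<open>The chain inside child \<open>i\<close> runs while the groups on
      \<open>Y D\<close> rest. A part of \<open>W i\<close> has one neighbourhood in
      \<open>S i\<close>, so it is homogeneous to each single vertex of \<open>X\<close>; to the
      groups avoiding \<open>X\<close> it is not adjacent at all.\<close>
    have step1: "merge_chain G ?d (singletons (W i) \<union> fibres h (Y D))
        (fibres (nbrs_in G (S i)) (W i) \<union> fibres h (Y D))"
    proof (rule merge_chain_Un[OF chain[OF i] boundR])
      fix A B assume A: "A \<in> fibres (nbrs_in G (S i)) (W i)" and B: "B \<in> fibres h (Y D)"
      have BY: "B \<subseteq> Y D" and AW: "A \<subseteq> W i" using A B by (auto simp: fibres_def)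
      show "\<not> mixed G A B"
      proof (cases "B \<inter> X = {}")
        case True
        have "{a, b} \<notin> edges G" if "a \<in> A" "b \<in> B" for a b
          using far[OF i] that True AW BY VU(2) dWY by blast
        then show ?thesis unfolding mixed_def by blast
      next
        case False
        then obtain u where u: "B = {u}" "u \<in> X" using real[OF B VU(2)] by blast
        have "u \<notin> W i" using u XW[OF i] by blast
        have "{a, u} \<in> edges G \<longleftrightarrow> {b, u} \<in> edges G" if "a \<in> A" "b \<in> A" for a b
        proof -
          have ab: "a \<in> W i" "b \<in> W i" using AW that by auto
          have "nbrs_in G (S i) a = nbrs_in G (S i) b" using A that by (auto simp: fibres_def)
          then show ?thesis
            using out[OF i ab(1) \<open>u \<notin> W i\<close>] out[OF i ab(2) \<open>u \<notin> W i\<close>]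
            unfolding nbrs_in_def by blast
        qed
        then show ?thesis unfolding mixed_def u by blast
      qed
    qed (use dWY in auto)
    define near where "near l l' \<longleftrightarrow> fst l = fst l' \<or> {fst l, fst l'} \<in> red H"
      for l l' :: "'h \<times> 'c"
    let ?P = "fibres (nbrs_in G (S i)) (W i) \<union> fibres h (Y D)"
    \<comment> \<open>The at most \<open>m\<close> parts of the child join the groups of
      \<open>h\<close>. They are counted on top of the \<open>m * (w + 1)\<close> parts bundled at a
      point and its red neighbours, which again gives \<open>m * (w + 2)\<close>.\<close>
    have step2: "merge_chain G ?d ?P (fibres h V)"
    proof (rule merge_chain_coarsen[where near = near])
      have fin: "finite (W i)" "finite (Y D)" using VU finU finite_subset by blast+
      then show "finite ?P" by simp
      show "{} \<notin> ?P" "\<Union> ?P = V" using Vi by auto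
      show "h a = h b" if "C \<in> ?P" "a \<in> C" "b \<in> C" for C a b
        using that determined[OF i, of a b] unfolding fibres_def h_def by auto
      show "\<not> mixed G {c \<in> V. h c = h a} {c \<in> V. h c = h b}" if "\<not> near (h a) (h b)" for a b
      proof -
        have no: "\<not> mixed G {c \<in> U. h c = h a} {c \<in> U. h c = h b}"
          using that unfolding h_def by (intro models_not_mixed[OF mod]) (auto simp: near_def)
        have "mixed G {c \<in> U. h c = h a} {c \<in> U. h c = h b}"
          if "mixed G {c \<in> V. h c = h a} {c \<in> V. h c = h b}"
          by (rule mixed_mono[OF that]) (use VU(1) in blast)+
        then show ?thesis using no by blast
      qed
      fix a
      define Z where "Z = insert (\<beta> a) {v. {\<beta> a, v} \<in> red H}"
      have finZ: "finite Z" using red_neighbours(1)[OF wf deg] by (simp add: Z_def)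
      have cardZ: "card Z \<le> w + 1"
        using red_neighbours[OF wf deg, of "\<beta> a"] by (simp add: Z_def card_insert_if)
      have "card (\<tau> ` Y D) \<le> m"
        using card\<tau> card_mono[OF finite_imageI[OF finU] image_mono[OF VU(2)], of \<tau>] by linarith
      then have "card {C \<in> fibres h (Y D). \<exists>b\<in>C. \<beta> b \<in> Z} \<le> m * card Z"
        unfolding h_def by (rule card_fibres_over[OF fin(2) finZ])
      also have "\<dots> \<le> m * (w + 1)" using cardZ by (rule mult_le_mono2)
      finally have old: "card {C \<in> fibres h (Y D). \<exists>b\<in>C. \<beta> b \<in> Z} \<le> m * (w + 1)" .
      have new: "card (fibres (nbrs_in G (S i)) (W i)) \<le> m"
        using card_fibres_le[OF fin(1), of "nbrs_in G (S i)"] types[OF i] by linarith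
      have "{C \<in> ?P. \<exists>b\<in>C. h b = h a \<or> near (h a) (h b)}
          \<subseteq> fibres (nbrs_in G (S i)) (W i) \<union> {C \<in> fibres h (Y D). \<exists>b\<in>C. \<beta> b \<in> Z}"
        unfolding near_def Z_def h_def by auto
      then have "card {C \<in> ?P. \<exists>b\<in>C. h b = h a \<or> near (h a) (h b)}
          \<le> card (fibres (nbrs_in G (S i)) (W i) \<union> {C \<in> fibres h (Y D). \<exists>b\<in>C. \<beta> b \<in> Z})"
        using fin by (intro card_mono) auto
      also have "\<dots> \<le> m + m * (w + 1)"
        using card_Un_le[of "fibres (nbrs_in G (S i)) (W i)" "{C \<in> fibres h (Y D). \<exists>b\<in>C. \<beta> b \<in> Z}"]
          old new by linarith
      finally show "card {C \<in> ?P. \<exists>b\<in>C. h b = h a \<or> near (h a) (h b)} \<le> ?d" by simp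
    qed
    \<comment> \<open>The vertices outside \<open>V\<close> belong to children not yet absorbed.
      They are not adjacent to groups avoiding \<open>X\<close>, and the other groups are
      singletons.\<close>
    have step12: "merge_chain G ?d ((singletons (W i) \<union> fibres h (Y D)) \<union> singletons (U - V))
        (fibres h V \<union> singletons (U - V))"
    proof (rule merge_chain_Un[OF merge_chain_trans[OF step1 step2] mixed_bounded_singletons])
      fix A B assume A: "A \<in> fibres h V" and "B \<in> singletons (U - V)"
      then obtain b where b: "B = {b}" "b \<in> U" "b \<notin> V" by (auto simp: singletons_def)
      show "\<not> mixed G A B"
      proof (cases "A \<inter> X = {}")
        case True
        obtain j where j: "j \<in> I" "b \<in> W j" "j \<notin> insert i D"
          using b U unfolding V_def Y_def by blast
        have "W j \<inter> V = {}"
          using j(1,3) disj[OF j(1)] XW[OF j(1)] D i unfolding V_def Y_def by blast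
        then have "{b, a} \<notin> edges G" if "a \<in> A" for a
          using far[OF j(1,2)] that True A VU(1) by (auto simp: fibres_def)
        then have "{a, b} \<notin> edges G" if "a \<in> A" for a using that by (metis insert_commute)
        then show ?thesis unfolding mixed_def b(1) by blast
      next
        case False
        then obtain u where "A = {u}" using real[OF A VU(1)] by blast
        then show ?thesis using b(1) not_mixed_singletons by simp
      qed
    qed (use Vi in auto)
    have "U - Y D = W i \<union> (U - V)" using Vi VU dWY by blast
    then have "fibres h (Y D) \<union> singletons (U - Y D)
        = (singletons (W i) \<union> fibres h (Y D)) \<union> singletons (U - V)"
      by (auto simp: singletons_def)
    then show ?case using merge_chain_trans[OF prev] step12 unfolding V_def by simp
  qed
  from this[of I] show ?thesis unfolding Y_def U[symmetric] h_def by (simp add: singletons_def)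
qed

section \<open>Rooted tree decompositions\<close>

definition is_path :: "'t graph \<Rightarrow> 't list \<Rightarrow> bool" where
  "is_path T xs \<longleftrightarrow> distinct xs \<and> set xs \<subseteq> verts T \<and>
     (\<forall>i. Suc i < length xs \<longrightarrow> {xs ! i, xs ! Suc i} \<in> edges T)"

lemma edge_verts:
  assumes "simple_graph T" "{u, v} \<in> edges T"
  shows "u \<in> verts T" "v \<in> verts T" "u \<noteq> v"
proof -
  have "{u, v} \<in> pairs (verts T)" using assms by (auto simp: simple_graph_def)
  then show "u \<in> verts T" "v \<in> verts T" "u \<noteq> v" unfolding pairs_def by (auto simp: doubleton_eq_iff)
qed

text \<open>The end of a longest path is a leaf: a neighbour off the path would extend it, and a
  neighbour at position 2 or later would close a cycle.\<close>

lemma tree_leaf: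
  assumes T: "is_tree T" and two: "r \<in> verts T" "s \<in> verts T" "r \<noteq> s"
  obtains l p where "l \<in> verts T" "p \<in> verts T" "l \<noteq> p" "{l, p} \<in> edges T"
    "\<And>q. {l, q} \<in> edges T \<Longrightarrow> q = p"
proof -
  have sg: "simple_graph T" and fin: "finite (verts T)" and con: "connected_graph T"
    and acyclic: "\<nexists>xs. is_cycle T xs"
    using T by (auto simp: is_tree_def simple_graph_def)
  have "(r, s) \<in> {(a, b). {a, b} \<in> edges T}\<^sup>*" using con two by (simp add: connected_graph_def)
  then obtain z where z: "{r, z} \<in> edges T" using two(3) by (auto elim: converse_rtranclE)
  have "is_path T [r, z]"
    using edge_verts[OF sg z] z by (auto simp: is_path_def less_Suc_eq)
  moreover have "length xs \<le> card (verts T)" if "is_path T xs" for xs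
    using that fin unfolding is_path_def by (metis card_mono distinct_card)
  then have "\<forall>xs. is_path T xs \<longrightarrow> length xs < Suc (card (verts T))" by (simp add: le_imp_less_Suc)
  ultimately obtain xs where xs: "is_path T xs" and maxi: "\<And>ys. is_path T ys \<Longrightarrow> length ys \<le> length xs"
    using ex_has_greatest_nat[of "is_path T" "[r, z]" length "Suc (card (verts T))"] by blast
  have len: "2 \<le> length xs" using maxi[OF \<open>is_path T [r, z]\<close>] by simp
  define l p where "l = xs ! 0" and "p = xs ! 1"
  have lp: "{l, p} \<in> edges T" using xs len unfolding is_path_def l_def p_def by auto
  have "q = p" if q: "{l, q} \<in> edges T" for q
  proof -
    have "q \<in> set xs"
    proof (rule ccontr)
      assume "q \<notin> set xs"
      moreover have "{(q # xs) ! i, (q # xs) ! Suc i} \<in> edges T" if "Suc i < length (q # xs)" for i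
        using that q xs unfolding is_path_def l_def by (cases i) (auto simp: insert_commute)
      ultimately have "is_path T (q # xs)"
        using xs edge_verts(2)[OF sg q] unfolding is_path_def by simp
      then show False using maxi by fastforce
    qed
    then obtain j where j: "j < length xs" "q = xs ! j" by (metis in_set_conv_nth)
    have "j \<noteq> 0" using edge_verts(3)[OF sg q] j(2) unfolding l_def by metis
    moreover have "\<not> 2 \<le> j"
    proof
      assume "2 \<le> j"
      have "is_cycle T (take (Suc j) xs)"
        unfolding is_cycle_def
      proof (intro conjI allI impI)
        show "3 \<le> length (take (Suc j) xs)" using \<open>2 \<le> j\<close> j by simp
        show "distinct (take (Suc j) xs)" using xs by (simp add: is_path_def)
        fix i assume "i < length (take (Suc j) xs)"
        then have i: "i \<le> j" "length (take (Suc j) xs) = Suc j" using j by auto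
        show "{take (Suc j) xs ! i, take (Suc j) xs ! (Suc i mod length (take (Suc j) xs))} \<in> edges T"
        proof (cases "i = j")
          case True
          then show ?thesis using i q j by (simp add: l_def insert_commute)
        next
          case False
          then have "Suc i < length xs" "Suc i < Suc j" using i j by auto
          then show ?thesis using xs i unfolding is_path_def by simp
        qed
      qed
      then show False using acyclic by blast
    qed
    ultimately have "j = 1" by linarith
    then show ?thesis using j p_def by simp
  qed
  then show ?thesis using that[of l p] edge_verts[OF sg lp] lp by blast
qed

text \<open>Replacing each visit to \<open>l\<close> by its only neighbour \<open>p\<close> turns
  walks of \<open>T\<close> into walks avoiding \<open>l\<close>, so connectivity survives.\<close>

lemma tree_delete_leaf:
  assumes T: "is_tree T" and l: "l \<in> verts T" "p \<in> verts T" "l \<noteq> p" "{l, p} \<in> edges T"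
    and leaf: "\<And>q. {l, q} \<in> edges T \<Longrightarrow> q = p"
  shows "is_tree (induced T (verts T - {l}))"
proof -
  let ?T = "induced T (verts T - {l})"
  have sg: "simple_graph T" and con: "connected_graph T" using T by (auto simp: is_tree_def)
  have edge: "{a, b} \<in> edges ?T" if "{a, b} \<in> edges T" "a \<noteq> l" "b \<noteq> l" for a b
    using that edge_verts[OF sg that(1)] by (auto simp: induced_def)
  have "(u, if v = l then p else v) \<in> {(a, b). {a, b} \<in> edges ?T}\<^sup>*"
    if "u \<noteq> l" "(u, v) \<in> {(a, b). {a, b} \<in> edges T}\<^sup>*" for u v
    using that(2)
  proof (induction rule: rtrancl_induct)
    case base
    then show ?case using that(1) by simp
  next
    case (step y z)
    then have yz: "{y, z} \<in> edges T" "{z, y} \<in> edges T" by (auto simp: insert_commute)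
    show ?case
    proof (cases "y = l \<or> z = l")
      case True
      then have "y = l \<and> z = p \<or> z = l \<and> y = p" using leaf yz by blast
      then show ?thesis using step.IH l(3) by auto
    next
      case False
      then have "(y, z) \<in> {(a, b). {a, b} \<in> edges ?T}" using edge yz by blast
      then show ?thesis using step.IH False by (simp add: rtrancl.rtrancl_into_rtrancl)
    qed
  qed
  note path = this
  have "connected_graph ?T"
    unfolding connected_graph_def
  proof (intro ballI)
    fix u v assume "u \<in> verts ?T" "v \<in> verts ?T"
    then have uv: "u \<in> verts T" "v \<in> verts T" "u \<noteq> l" "v \<noteq> l" by (auto simp: induced_def)
    then have "(u, v) \<in> {(a, b). {a, b} \<in> edges T}\<^sup>*" using con unfolding connected_graph_def by blast
    then have "(u, if v = l then p else v) \<in> {(a, b). {a, b} \<in> edges ?T}\<^sup>*"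
      by (rule path[OF uv(3)])
    then show "(u, v) \<in> {(a, b). {a, b} \<in> edges ?T}\<^sup>*" by (simp only: uv(4) if_False)
  qed
  moreover have "is_cycle T xs" if "is_cycle ?T xs" for xs
    using that by (auto simp: is_cycle_def induced_def)
  ultimately show ?thesis
    using T simple_graph_induced[OF sg] l(2,3) unfolding is_tree_def by (auto simp: induced_def)
qed

text \<open>Leaves are deleted one by one, and a restored leaf hangs below its only neighbour.
  \<open>rank\<close> increases strictly away from the root, which supports induction along the tree
  in both directions.\<close>

lemma tree_parent:
  fixes T :: "'t graph"
  assumes "is_tree T"
  shows "\<exists>r par (rank :: 't \<Rightarrow> nat). r \<in> verts T \<and>
      (\<forall>t \<in> verts T - {r}. par t \<in> verts T \<and> rank (par t) < rank t) \<and>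
      edges T = {{t, par t} | t. t \<in> verts T - {r}}"
  using assms
proof (induction "card (verts T)" arbitrary: T rule: less_induct)
  case less
  have sg: "simple_graph T" and fin: "finite (verts T)" and ne: "verts T \<noteq> {}"
    using less.prems by (auto simp: is_tree_def simple_graph_def)
  obtain s where s: "s \<in> verts T" using ne by blast
  show ?case
  proof (cases "verts T = {s}")
    case True
    have "e \<notin> edges T" for e
      using sg True unfolding simple_graph_def pairs_def by auto
    then have "edges T = {}" by blast
    then show ?thesis using True by (intro exI[of _ s]) auto
  next
    case False
    then obtain s' where "s' \<in> verts T" "s' \<noteq> s" using s by blast
    then obtain l p where l: "l \<in> verts T" "p \<in> verts T" "l \<noteq> p" "{l, p} \<in> edges T"
        "\<And>q. {l, q} \<in> edges T \<Longrightarrow> q = p"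
      using tree_leaf[OF less.prems s] by metis
    let ?T = "induced T (verts T - {l})"
    have vT: "verts ?T = verts T - {l}" by (auto simp: induced_def)
    have "card (verts ?T) < card (verts T)" unfolding vT using l(1) fin by (intro card_Diff1_less)
    then obtain r par and rank :: "'t \<Rightarrow> nat" where r: "r \<in> verts ?T"
        and par: "\<forall>t \<in> verts ?T - {r}. par t \<in> verts ?T \<and> rank (par t) < rank t"
        and edges: "edges ?T = {{t, par t} | t. t \<in> verts ?T - {r}}"
      using less.hyps[OF _ tree_delete_leaf[OF less.prems l]] by blast
    let ?par = "par(l := p)" and ?rank = "rank(l := Suc (rank p))"
    have "edges T = insert {l, p} (edges ?T)"
    proof (intro set_eqI iffI)
      fix e assume e: "e \<in> edges T"
      then have "e \<in> pairs (verts T)" using sg by (auto simp: simple_graph_def)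
      then obtain u v where uv: "e = {u, v}" "u \<in> verts T" "v \<in> verts T" unfolding pairs_def by blast
      show "e \<in> insert {l, p} (edges ?T)"
      proof (cases "l \<in> e")
        case True
        then have "e = {l, u} \<or> e = {l, v}" using uv by auto
        then show ?thesis using l(5) e by auto
      next
        case False
        then show ?thesis using e uv by (auto simp: induced_def)
      qed
    qed (use l(4) in \<open>auto simp: induced_def\<close>)
    also have "\<dots> = {{t, ?par t} | t. t \<in> verts T - {r}}"
      unfolding edges vT using l(1) r vT by auto
    finally have "edges T = {{t, ?par t} | t. t \<in> verts T - {r}}" .
    moreover have "\<forall>t \<in> verts T - {r}. ?par t \<in> verts T \<and> ?rank (?par t) < ?rank t"
      using par l(2,3) vT by auto
    ultimately show ?thesis
      using r vT by (intro exI[of _ r] exI[of _ ?par] exI[of _ ?rank]) simp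
  qed
qed

section \<open>Topmost bags and adhesion sets in a rooted decomposition\<close>

locale rooted_decomposition =
  fixes G :: "'a graph" and T :: "'t graph" and B :: "'t \<Rightarrow> 'a set"
    and r :: 't and par :: "'t \<Rightarrow> 't" and rank :: "'t \<Rightarrow> nat"
  assumes graph: "simple_graph G" and decomposition: "tree_decomposition G T B"
    and root: "r \<in> verts T"
    and parent: "t \<in> verts T \<Longrightarrow> t \<noteq> r \<Longrightarrow> par t \<in> verts T \<and> rank (par t) < rank t"
    and tree_edges: "edges T = {{t, par t} | t. t \<in> verts T - {r}}"
begin

definition above :: "('t \<times> 't) set" where
  "above = {(t, par t) | t. t \<in> verts T - {r}}\<^sup>*"

definition desc :: "'t \<Rightarrow> 't set" where
  "desc t = {x \<in> verts T. (x, t) \<in> above}"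

text \<open>The node of the topmost bag containing \<open>v\<close>, described locally: from any
  other bag containing \<open>v\<close>, the step to the parent stays among such bags.\<close>

definition home :: "'a \<Rightarrow> 't" where
  "home v = (SOME m. m \<in> verts T \<and> v \<in> B m \<and>
     (\<forall>x\<in>verts T. v \<in> B x \<longrightarrow> x \<noteq> m \<longrightarrow> x \<noteq> r \<and> v \<in> B (par x)))"

text \<open>The empty set at the root makes all types there equal, so the bottom-up process ends
  with at most one part.\<close>

definition sep :: "'t \<Rightarrow> 'a set" where
  "sep t = (if t = r then {} else B t \<inter> B (par t))"

definition below :: "'t \<Rightarrow> 'a set" where
  "below t = {v \<in> verts G. home v \<in> desc t}"

definition own :: "'t \<Rightarrow> 'a set" where
  "own t = {v \<in> verts G. home v = t}"

definition children :: "'t \<Rightarrow> 't set" where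
  "children t = {c \<in> verts T - {r}. par c = t}"

lemma finite_tree: "finite (verts T)"
  using decomposition by (auto simp: tree_decomposition_def is_tree_def simple_graph_def)

lemma finite_graph: "finite (verts G)"
  using graph by (simp add: simple_graph_def)

lemma bag_subset: "t \<in> verts T \<Longrightarrow> B t \<subseteq> verts G"
  using decomposition by (simp add: tree_decomposition_def)

lemma above_refl [simp]: "(x, x) \<in> above"
  by (simp add: above_def)

lemma above_trans: "(x, y) \<in> above \<Longrightarrow> (y, z) \<in> above \<Longrightarrow> (x, z) \<in> above"
  unfolding above_def by (rule rtrancl_trans)

lemma above_par: "x \<in> verts T \<Longrightarrow> x \<noteq> r \<Longrightarrow> (x, par x) \<in> above"
  unfolding above_def by blast

lemma above_rank: "(x, y) \<in> above \<Longrightarrow> x = y \<or> rank y < rank x"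
  unfolding above_def
proof (induction rule: rtrancl_induct)
  case (step y z)
  then show ?case using parent by fastforce
qed simp

lemma above_step: "(x, y) \<in> above \<Longrightarrow> x \<noteq> y \<Longrightarrow> x \<in> verts T \<and> x \<noteq> r \<and> (par x, y) \<in> above"
  unfolding above_def by (erule converse_rtranclE) auto

lemma above_linear: "(x, y) \<in> above \<Longrightarrow> (x, z) \<in> above \<Longrightarrow> (y, z) \<in> above \<or> (z, y) \<in> above"
  unfolding above_def
  by (rule single_valued_confluent) (auto simp: single_valued_def)

lemma desc_self: "t \<in> verts T \<Longrightarrow> t \<in> desc t"
  by (simp add: desc_def)

text \<open>The node of least rank among those whose bag contains \<open>v\<close> serves. If
  another such node \<open>x\<close> had no parent among them, every walk from \<open>x\<close>
  within these nodes would stay below \<open>x\<close>; by connectivity the least node would lie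
  below \<open>x\<close> and have larger rank.\<close>

lemma home_exists:
  assumes v: "v \<in> verts G"
  shows "\<exists>m. m \<in> verts T \<and> v \<in> B m \<and>
     (\<forall>x\<in>verts T. v \<in> B x \<longrightarrow> x \<noteq> m \<longrightarrow> x \<noteq> r \<and> v \<in> B (par x))"
proof -
  define N where "N = {t \<in> verts T. v \<in> B t}"
  have "is_tree (induced T N)"
    using decomposition v by (simp add: tree_decomposition_def N_def)
  then have con: "connected_graph (induced T N)" and "N \<noteq> {}"
    by (auto simp: is_tree_def induced_def)
  have "finite N" using finite_tree by (simp add: N_def)
  define m where "m = arg_min_on rank N"
  have m: "m \<in> N" "\<And>x. x \<in> N \<Longrightarrow> rank m \<le> rank x"
    using arg_min_if_finite[OF \<open>finite N\<close> \<open>N \<noteq> {}\<close>, of rank] by (auto simp: m_def not_less)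
  have "x \<noteq> r \<and> v \<in> B (par x)" if x: "x \<in> verts T" "v \<in> B x" "x \<noteq> m" for x
  proof (rule ccontr)
    assume no: "\<not> (x \<noteq> r \<and> v \<in> B (par x))"
    have "x \<in> N" using x by (simp add: N_def)
    then have "(x, m) \<in> {(a, b). {a, b} \<in> edges (induced T N)}\<^sup>*"
      using con m(1) unfolding connected_graph_def by (simp add: induced_def N_def)
    then have "(m, x) \<in> above"
    proof (induction rule: rtrancl_induct)
      case (step y z)
      then have yz: "{y, z} \<in> edges T" "y \<in> N" "z \<in> N" by (auto simp: induced_def)
      obtain t where t: "{y, z} = {t, par t}" "t \<in> verts T - {r}"
        using yz(1) unfolding tree_edges by auto
      from t(1) consider "y = t" "z = par t" | "z = t" "y = par t" by (auto simp: doubleton_eq_iff)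
      then show ?case
      proof cases
        case 1
        have "y \<noteq> x" using 1 no t(2) yz(3) by (auto simp: N_def)
        then show ?thesis using above_step[OF step.IH] 1 by simp
      next
        case 2
        then show ?thesis using above_par[of z] above_trans[OF _ step.IH] t(2) by auto
      qed
    qed simp
    then have "m = x \<or> rank x < rank m" by (rule above_rank)
    then show False using m(2)[OF \<open>x \<in> N\<close>] x(3) by auto
  qed
  then show ?thesis using m(1) by (auto simp: N_def)
qed

lemma home:
  assumes "v \<in> verts G"
  shows "home v \<in> verts T" "v \<in> B (home v)"
    and "\<And>x. x \<in> verts T \<Longrightarrow> v \<in> B x \<Longrightarrow> x \<noteq> home v \<Longrightarrow> x \<noteq> r \<and> v \<in> B (par x)"
proof -
  have *: "home v \<in> verts T \<and> v \<in> B (home v) \<and>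
      (\<forall>x\<in>verts T. v \<in> B x \<longrightarrow> x \<noteq> home v \<longrightarrow> x \<noteq> r \<and> v \<in> B (par x))"
    unfolding home_def by (rule someI_ex[OF home_exists[OF assms]])
  then show "home v \<in> verts T" "v \<in> B (home v)" by auto
  show "x \<noteq> r \<and> v \<in> B (par x)" if "x \<in> verts T" "v \<in> B x" "x \<noteq> home v" for x
    using * that by blast
qed

lemma bag_below_home:
  assumes "v \<in> verts G" "x \<in> verts T" "v \<in> B x"
  shows "(x, home v) \<in> above"
  using assms(2,3)
proof (induction "rank x" arbitrary: x rule: less_induct)
  case less
  show ?case
  proof (cases "x = home v")
    case False
    then have "x \<noteq> r" "v \<in> B (par x)" using home(3)[OF assms(1)] less.prems by auto
    then show ?thesis
      using less.hyps[of "par x"] parent[of x] above_trans[OF above_par[of x]] less.prems(1) by blast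
  qed simp
qed

text \<open>Climbing from \<open>x\<close> to the topmost bag of \<open>v\<close> leaves the subtree
  at \<open>c\<close> through the edge from \<open>c\<close> to its parent, and \<open>v\<close>
  lies in every bag on the way.\<close>

lemma leaves_below:
  assumes "v \<in> verts G" "home v \<notin> desc c" "x \<in> desc c" "v \<in> B x" "c \<in> verts T"
  shows "c \<noteq> r \<and> v \<in> B c \<and> v \<in> B (par c)"
  using assms(3,4)
proof (induction "rank x" arbitrary: x rule: less_induct)
  case less
  have x: "x \<in> verts T" "x \<noteq> home v" using less.prems(1) assms(2) by (auto simp: desc_def)
  then have up: "x \<noteq> r" "v \<in> B (par x)" using home(3)[OF assms(1)] less.prems(2) by auto
  show ?case
  proof (cases "x = c")
    case True
    then show ?thesis using up less.prems(2) by simp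
  next
    case False
    then have "par x \<in> desc c"
      using above_step[of x c] less.prems(1) parent x(1) up(1) by (auto simp: desc_def)
    then show ?thesis using less.hyps up parent x(1) by blast
  qed
qed

text \<open>A bag containing the edge lies at or below the topmost bag of \<open>a\<close>, hence in
  the subtree of \<open>c\<close>; \<open>leaves_below\<close> then applies to
  \<open>b\<close>.\<close>

lemma edge_leaves_below:
  assumes "{a, b} \<in> edges G" "a \<in> below c" "b \<notin> below c" "c \<in> verts T"
  shows "c \<noteq> r \<and> b \<in> sep c"
proof -
  have "\<forall>e\<in>edges G. \<exists>t\<in>verts T. e \<subseteq> B t" using decomposition by (simp add: tree_decomposition_def)
  from bspec[OF this assms(1)] obtain x where x: "x \<in> verts T" "a \<in> B x" "b \<in> B x" by auto
  have V: "a \<in> verts G" "b \<in> verts G" using edge_verts[OF graph assms(1)] by auto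
  have "x \<in> desc c"
    using above_trans[OF bag_below_home[OF V(1) x(1,2)]] assms(2) x(1) by (simp add: below_def desc_def)
  moreover have "home b \<notin> desc c" using assms(3) V(2) by (simp add: below_def)
  ultimately show ?thesis using leaves_below[OF V(2) _ _ x(3) assms(4)] by (simp add: sep_def)
qed

lemma desc_children:
  assumes "t \<in> verts T"
  shows "desc t = insert t (\<Union>c\<in>children t. desc c)"
proof (intro set_eqI iffI)
  fix x assume "x \<in> desc t"
  then have "(x, t) \<in> above" and x: "x \<in> verts T" by (auto simp: desc_def)
  then have "x = t \<or> (\<exists>c\<in>children t. (x, c) \<in> above)"
    unfolding above_def children_def by (cases rule: rtranclE) auto
  then show "x \<in> insert t (\<Union>c\<in>children t. desc c)" using x by (auto simp: desc_def)
next
  fix x assume "x \<in> insert t (\<Union>c\<in>children t. desc c)"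
  then consider "x = t" | c where "c \<in> verts T" "c \<noteq> r" "par c = t" "x \<in> verts T" "(x, c) \<in> above"
    by (auto simp: children_def desc_def)
  then show "x \<in> desc t"
  proof cases
    case 1
    then show ?thesis using assms desc_self by simp
  next
    case (2 c)
    then show ?thesis using above_trans[OF 2(5)] above_par[of c] by (simp add: desc_def)
  qed
qed

lemma below_children: "t \<in> verts T \<Longrightarrow> below t = own t \<union> (\<Union>c\<in>children t. below c)"
  using desc_children by (auto simp: below_def own_def)

text \<open>The ancestors of a node form a chain, so overlapping siblings would be comparable, and
  their parent would lie at or below one of its own children.\<close>

lemma children_disjoint:
  assumes "c \<in> children t" "c' \<in> children t" "c \<noteq> c'"
  shows "below c \<inter> below c' = {}"
proof -
  have no: False if "(c, c') \<in> above" "c \<in> children t" "c' \<in> children t" "c \<noteq> c'" for c c'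
  proof -
    have "(t, c') \<in> above" using above_step[OF that(1,4)] that(2) by (simp add: children_def)
    then have "t = c' \<or> rank c' < rank t" by (rule above_rank)
    moreover have "rank t < rank c'" using that(3) parent[of c'] by (simp add: children_def)
    ultimately show False by auto
  qed
  show ?thesis
  proof (rule ccontr)
    assume "below c \<inter> below c' \<noteq> {}"
    then obtain x where "(x, c) \<in> above" "(x, c') \<in> above" by (auto simp: below_def desc_def)
    then have "(c, c') \<in> above \<or> (c', c) \<in> above" by (rule above_linear)
    then show False using no[of c c'] no[of c' c] assms by auto
  qed
qed

lemma own_child_disjoint: "c \<in> children t \<Longrightarrow> own t \<inter> below c = {}"
  using above_rank[of t c] parent[of c] by (fastforce simp: own_def below_def desc_def children_def)

lemma own_bag: "v \<in> own t \<Longrightarrow> v \<in> B t"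
  using home(2) by (auto simp: own_def)

text \<open>The topmost node of \<open>v\<close> lies at or above \<open>t\<close> because
  \<open>v \<in> B t\<close>, and at or below \<open>t\<close> because
  \<open>v \<in> below t\<close>.\<close>

lemma bag_own:
  assumes "v \<in> B t" "v \<in> below t" "t \<in> verts T"
  shows "v \<in> own t"
proof -
  have v: "v \<in> verts G" "(home v, t) \<in> above" using assms(2) by (auto simp: below_def desc_def)
  have "(t, home v) \<in> above" using bag_below_home[OF v(1) assms(3,1)] .
  then have "t = home v \<or> rank (home v) < rank t" by (rule above_rank)
  then have "home v = t" using above_rank[OF v(2)] by auto
  then show ?thesis using v by (simp add: own_def)
qed

lemma sep_subset:
  assumes "c \<in> children t"
  shows "sep c \<subseteq> B t" "sep c \<subseteq> verts G"
  using assms bag_subset[of t] parent[of c] by (auto simp: sep_def children_def)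

lemma sep_adhesion_set: "c \<in> children t \<Longrightarrow> sep c \<in> adhesion_sets T B"
  unfolding adhesion_sets_def sep_def children_def using tree_edges by auto

lemma card_adhesion_set:
  assumes "S \<in> adhesion_sets T B"
  shows "card S \<le> adhesion T B"
proof -
  have "adhesion_sets T B \<subseteq> (\<lambda>(s, t). B s \<inter> B t) ` (verts T \<times> verts T)"
    unfolding adhesion_sets_def
    using tree_edges parent by (fastforce simp: doubleton_eq_iff)
  then have "finite (adhesion_sets T B)" using finite_tree by (meson finite_SigmaI finite_imageI finite_subset)
  then show ?thesis using assms unfolding adhesion_def by (intro Max_ge) auto
qed

lemma card_types:
  assumes "t \<in> verts T" "adhesion T B \<le> k"
  shows "finite (nbrs_in G (sep t) ` V)" "card (nbrs_in G (sep t) ` V) \<le> 2 ^ k"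
proof -
  have fin: "finite (sep t)" and le: "card (sep t) \<le> k"
  proof -
    show "finite (sep t)"
      using bag_subset[OF assms(1)] finite_graph by (auto simp: sep_def intro: finite_subset)
    show "card (sep t) \<le> k"
    proof (cases "t = r")
      case False
      then have "t \<in> children (par t)" using assms(1) by (simp add: children_def)
      then show ?thesis using sep_adhesion_set card_adhesion_set assms(2) order_trans by blast
    qed (simp add: sep_def)
  qed
  have sub: "nbrs_in G (sep t) ` V \<subseteq> Pow (sep t)" by (auto simp: nbrs_in_def)
  then show "finite (nbrs_in G (sep t) ` V)" using fin by (meson finite_Pow_iff finite_subset)
  have "card (nbrs_in G (sep t) ` V) \<le> 2 ^ card (sep t)"
    using card_mono[OF _ sub] fin by (simp add: card_Pow)
  also have "\<dots> \<le> 2 ^ k" using le by (intro power_increasing) auto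
  finally show "card (nbrs_in G (sep t) ` V) \<le> 2 ^ k" .
qed

text \<open>A neighbour in \<open>sep t\<close> is not below \<open>c\<close>, since it lies in
  \<open>B t\<close> and would then be an own vertex of \<open>t\<close>; hence it lies in
  \<open>sep c\<close>. Types at a child therefore determine types at its parent.\<close>

lemma nbrs_in_parent:
  assumes "c \<in> children t" "t \<in> verts T" "a \<in> below c"
  shows "nbrs_in G (sep t) a = nbrs_in G (sep c) a \<inter> sep t"
proof -
  have "b \<in> sep c" if "b \<in> sep t" "{a, b} \<in> edges G" for b
  proof (rule ccontr)
    have c: "c \<in> verts T" using assms(1) by (simp add: children_def)
    assume "b \<notin> sep c"
    then have "b \<in> below c" using edge_leaves_below[OF that(2) assms(3) _ c] by blast
    then have "b \<in> below t" "b \<notin> own t"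
      using below_children[OF assms(2)] own_child_disjoint[OF assms(1)] assms(1) by auto
    then show False using bag_own[OF _ _ assms(2)] that(1) by (auto simp: sep_def split: if_splits)
  qed
  then show ?thesis by (auto simp: nbrs_in_def)
qed

lemma not_adjacent_below:
  assumes "c \<in> children t" "t \<in> verts T" "a \<in> below c" "b \<in> below t" "b \<notin> below c" "b \<notin> sep c"
  shows "{a, b} \<notin> edges G"
  using edge_leaves_below[OF _ assms(3,5)] assms(1,6) by (auto simp: children_def)

lemma sep_own: "c \<in> children t \<Longrightarrow> t \<in> verts T \<Longrightarrow> sep c \<inter> below t \<subseteq> own t"
  using sep_subset(1) bag_own by blast

text \<open>Common core of both claims: \<open>H t\<close> is the trigraph followed at node
  \<open>t\<close>, \<open>\<beta> t\<close> is the bundling, and the flag \<open>\<phi> t\<close>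
  refines the type given by the neighbourhood towards the parent. With at most \<open>q\<close>
  flags there are at most \<open>2 ^ k * q\<close> types.\<close>

lemma tww_le_parts:
  fixes H :: "'t \<Rightarrow> 'h trigraph" and \<beta> :: "'t \<Rightarrow> 'a \<Rightarrow> 'h" and \<phi> :: "'t \<Rightarrow> 'a \<Rightarrow> 'c"
  assumes k: "adhesion T B \<le> k" and q: "1 \<le> q"
    and wf: "\<And>t. t \<in> verts T \<Longrightarrow> wf_trigraph (H t)"
    and tww: "\<And>t. t \<in> verts T \<Longrightarrow> tww (H t) \<le> w"
    and range: "\<And>t. t \<in> verts T \<Longrightarrow> \<beta> t ` below t \<subseteq> insert z (tverts (H t))"
    and mod: "\<And>t. t \<in> verts T \<Longrightarrow>
      models G (below t) (H t) (\<beta> t) (\<lambda>a. (nbrs_in G (sep t) a, \<phi> t a)) \<gamma>"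
    and single: "\<And>t u b. t \<in> verts T \<Longrightarrow> u \<in> own t \<Longrightarrow> b \<in> below t \<Longrightarrow>
      \<beta> t b = \<beta> t u \<Longrightarrow> \<phi> t b = \<phi> t u \<Longrightarrow> b = u"
    and const: "\<And>t c a b. t \<in> verts T \<Longrightarrow> c \<in> children t \<Longrightarrow> a \<in> below c \<Longrightarrow> b \<in> below c \<Longrightarrow>
      \<beta> t a = \<beta> t b \<and> \<phi> t a = \<phi> t b"
    and flags: "\<And>t. t \<in> verts T \<Longrightarrow> finite (\<phi> t ` below t) \<and> card (\<phi> t ` below t) \<le> q"
  shows "tww (trigraph_of G) \<le> 2 ^ k * q * (w + 2)"
proof -
  define m :: nat where "m = 2 ^ k * q"
  have "2 ^ k * 1 \<le> (2 ^ k * q :: nat)" using q by (intro mult_le_mono) auto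
  then have km: "2 ^ k \<le> m" unfolding m_def by simp
  have finb: "finite (below t)" for t using finite_graph by (auto simp: below_def intro: finite_subset)
  have main: "merge_chain G (m * (w + 2)) (singletons (below t)) (fibres (nbrs_in G (sep t)) (below t))"
    if "t \<in> verts T" for t
    using that
  \<comment> \<open>Ranks grow away from the root, so this measure treats children before
    parents.\<close>
  proof (induction "Max (rank ` verts T) - rank t" arbitrary: t rule: less_induct)
    case less
    note t = less.prems
    let ?\<tau> = "\<lambda>a. (nbrs_in G (sep t) a, \<phi> t a)"
    have child: "c \<in> verts T" if "c \<in> children t" for c using that by (simp add: children_def)
    have card\<tau>: "card (?\<tau> ` below t) \<le> m"
    proof -
      have "card (?\<tau> ` below t) \<le> card (nbrs_in G (sep t) ` below t \<times> \<phi> t ` below t)"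
        using card_types(1)[OF t k] flags[OF t] by (intro card_mono) auto
      also have "\<dots> \<le> m"
        unfolding m_def card_cartesian_product
        using card_types(2)[OF t k] flags[OF t] by (intro mult_le_mono) auto
      finally show ?thesis .
    qed
    obtain Hs where Hs: "contraction_sequence Hs" "hd Hs = H t"
      "\<And>H'. H' \<in> set Hs \<Longrightarrow> max_red_degree H' \<le> tww (H t)"
      using tww_witness[of "H t"] wf[OF t] by (auto simp: wf_trigraph_def)
    have Hs': "max_red_degree H' \<le> w" if "H' \<in> set Hs" for H'
      using Hs(3)[OF that] tww[OF t] by linarith
    have deg: "max_red_degree (H t) \<le> w"
      using Hs' Hs(1,2) by (metis contraction_sequence_def hd_in_set)
    have "merge_chain G (m * (w + 2)) (singletons (below t)) (fibres (\<lambda>a. (\<beta> t a, ?\<tau> a)) (below t))"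
    proof (rule merge_chain_node[OF finb _ below_children[OF t] _ _ _ _ _ _ _ _ wf[OF t] deg mod[OF t] card\<tau>])
      show "finite (children t)" using finite_tree by (simp add: children_def)
      fix c assume c: "c \<in> children t"
      show "own t \<inter> below c = {}" by (rule own_child_disjoint[OF c])
      show "sep c \<inter> below t \<subseteq> own t" by (rule sep_own[OF c t])
      show "b \<in> sep c" if "a \<in> below c" "b \<notin> below c" "{a, b} \<in> edges G" for a b
        using edge_leaves_below[OF that(3,1,2) child[OF c]] by blast
      show "card (nbrs_in G (sep c) ` below c) \<le> m"
        using card_types(2)[OF child[OF c] k] km order_trans by blast
      have "rank t < rank c" "rank c \<le> Max (rank ` verts T)"
        using c parent finite_tree by (auto simp: children_def)
      then show "merge_chain G (m * (w + 2)) (singletons (below c)) (fibres (nbrs_in G (sep c)) (below c))"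
        using less.hyps[OF _ child[OF c]] by simp
      show "\<beta> t a = \<beta> t b \<and> ?\<tau> a = ?\<tau> b"
        if "a \<in> below c" "b \<in> below c" "nbrs_in G (sep c) a = nbrs_in G (sep c) b" for a b
        using const[OF t c that(1,2)] nbrs_in_parent[OF c t] that by simp
    next
      show "below c \<inter> below c' = {}" if "c \<in> children t" "c' \<in> children t" "c \<noteq> c'" for c c'
        using children_disjoint that .
      show "b = u" if "u \<in> own t" "b \<in> below t" "\<beta> t b = \<beta> t u" "?\<tau> b = ?\<tau> u" for u b
        using single[OF t that(1-3)] that(4) by simp
    qed
    \<comment> \<open>Following a contraction sequence of \<open>H t\<close> of optimal width and
      forgetting bundles and flags at the end leaves one part for each neighbourhood in
      \<open>sep t\<close>.\<close>
    moreover have "merge_chain G (m * (w + 2)) (fibres (\<lambda>a. (\<beta> t a, ?\<tau> a)) (below t))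
        (fibres (nbrs_in G (sep t)) (below t))"
      using merge_chain_along_contractions[OF finb card\<tau> _ Hs(1) Hs', of "nbrs_in G (sep t)" "\<beta> t" z G \<gamma>]
        wf[OF t] range[OF t] mod[OF t] unfolding Hs(2) by simp
    ultimately show ?case by (rule merge_chain_trans)
  qed
  have "(x, r) \<in> above" if "x \<in> verts T" for x
    using that
  proof (induction "rank x" arbitrary: x rule: less_induct)
    case less
    show ?case
    proof (cases "x = r")
      case False
      then show ?thesis
        using less.hyps[of "par x"] parent[of x] above_trans[OF above_par[of x]] less.prems by blast
    qed simp
  qed
  then have "below r = verts G" using home(1) by (auto simp: below_def desc_def)
  moreover have "nbrs_in G (sep r) = (\<lambda>_. {})" by (auto simp: nbrs_in_def sep_def)
  ultimately have chain: "merge_chain G (m * (w + 2)) (singletons (verts G)) (fibres (\<lambda>_. {} :: 'a set) (verts G))"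
    using main[OF root] by simp
  have "card ((\<lambda>_ :: 'a. {} :: 'a set) ` verts G) \<le> card {{} :: 'a set}" by (intro card_mono) auto
  then have "card (fibres (\<lambda>_. {} :: 'a set) (verts G)) \<le> 1"
    using card_fibres_le[OF finite_graph, of "\<lambda>_. {} :: 'a set"] by simp
  then show ?thesis using tww_le_merge_chain[OF graph chain] unfolding m_def by simp
qed

end

section \<open>Hatted and barred parts\<close>

lemma hat_black:
  fixes P :: "'a graph"
  shows "{Inl a, Inl b} \<in> black (hat_trigraph P \<S>) \<longleftrightarrow> {a, b} \<in> edges P"
    and "{Inr S, x} \<notin> black (hat_trigraph P \<S>)"
proof -
  have "(Inl :: 'a \<Rightarrow> 'a + 'a set) ` e = {Inl a, Inl b} \<longleftrightarrow> e = {a, b}" for e :: "'a set" and a b :: 'a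
    using inj_image_eq_iff[of "Inl :: 'a \<Rightarrow> 'a + 'a set" e "{a, b}"] by simp
  note inl = this
  show "{Inl a, Inl b} \<in> black (hat_trigraph P \<S>) \<longleftrightarrow> {a, b} \<in> edges P"
  proof
    assume "{Inl a, Inl b} \<in> black (hat_trigraph P \<S>)"
    then obtain e where "e \<in> edges P" "Inl ` e = {Inl a, Inl b :: 'a + 'a set}"
      unfolding hat_trigraph_def by auto
    then show "{a, b} \<in> edges P" using inl by simp
  next
    assume "{a, b} \<in> edges P"
    then have "Inl ` {a, b} \<in> black (hat_trigraph P \<S>)"
      unfolding hat_trigraph_def by (simp del: image_insert)
    then show "{Inl a, Inl b} \<in> black (hat_trigraph P \<S>)" by simp
  qed
  show "{Inr S, x} \<notin> black (hat_trigraph P \<S>)"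
    unfolding hat_trigraph_def by auto
qed

lemma bar_black:
  "{a, b} \<notin> red (bar_trigraph P \<S>) \<Longrightarrow> {a, b} \<in> black (bar_trigraph P \<S>) \<longleftrightarrow> {a, b} \<in> edges P"
  unfolding bar_trigraph_def Let_def by simp

context rooted_decomposition
begin

definition child_of :: "'t \<Rightarrow> 'a \<Rightarrow> 't" where
  "child_of t a = (THE c. c \<in> children t \<and> a \<in> below c)"

lemma child_of_eq: "c \<in> children t \<Longrightarrow> a \<in> below c \<Longrightarrow> child_of t a = c"
  unfolding child_of_def using children_disjoint by (intro the_equality) blast+

lemma below_cases:
  assumes "t \<in> verts T" "a \<in> below t"
  obtains "a \<in> own t" "home a = t"
  | "child_of t a \<in> children t" "a \<in> below (child_of t a)" "home a \<noteq> t" "a \<notin> own t"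
proof (cases "a \<in> own t")
  case True
  then show ?thesis using that(1) by (simp add: own_def)
next
  case False
  then obtain c where c: "c \<in> children t" "a \<in> below c" using below_children[OF assms(1)] assms(2) by blast
  have "a \<in> verts G" using assms(2) by (simp add: below_def)
  then have "home a \<noteq> t" using False by (simp add: own_def)
  then show ?thesis using that(2) c False by (simp add: child_of_eq)
qed

lemma part_edge_iff: "a \<in> B t \<Longrightarrow> b \<in> B t \<Longrightarrow> {a, b} \<in> edges (part G B t) \<longleftrightarrow> {a, b} \<in> edges G"
  by (auto simp: part_def induced_def)

lemma part_simple: "simple_graph (part G B t)"
  unfolding part_def by (rule simple_graph_induced[OF graph])

lemma verts_part: "t \<in> verts T \<Longrightarrow> verts (part G B t) = B t"
  using bag_subset by (auto simp: part_def induced_def)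

text \<open>Within \<open>below t\<close>, the set \<open>sep c\<close> consists of own vertices of
  \<open>t\<close>, so it contains nothing from below another child.\<close>

lemma not_adjacent_children:
  assumes t: "t \<in> verts T" and c: "c \<in> children t" "a \<in> below c" and d: "d \<in> children t" "b \<in> below d"
    and "c \<noteq> d"
  shows "{a, b} \<notin> edges G"
proof (rule not_adjacent_below[OF c(1) t c(2)])
  show b: "b \<in> below t" using below_children[OF t] d by blast
  show "b \<notin> below c" using children_disjoint[OF c(1) d(1) \<open>c \<noteq> d\<close>] d(2) by blast
  show "b \<notin> sep c" using sep_own[OF c(1) t] own_child_disjoint[OF d(1)] d(2) b by blast
qed

lemma not_adjacent_own:
  assumes t: "t \<in> verts T" and c: "c \<in> children t" "a \<in> below c" and "b \<in> own t" "b \<notin> sep c"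
  shows "{a, b} \<notin> edges G"
  using not_adjacent_below[OF c(1) t c(2)] own_child_disjoint[OF c(1)] below_children[OF t] assms(4,5)
  by blast

section \<open>Bundling for the hatted parts\<close>

definition hat_vertex :: "'t \<Rightarrow> 'a \<Rightarrow> 'a + 'a set" where
  "hat_vertex t a = (if home a = t then Inl a else Inr (sep (child_of t a)))"

lemma hat_red:
  assumes "t \<in> verts T" "c \<in> children t" "b \<in> sep c"
  shows "{Inr (sep c), Inl b} \<in> red (hat_trigraph (part G B t) (adhesion_sets T B))"
proof -
  have "sep c \<in> adhesion_sets T B" "sep c \<subseteq> verts (part G B t)"
    using sep_adhesion_set[OF assms(2)] sep_subset(1)[OF assms(2)] verts_part[OF assms(1)] by auto
  then have "{Inl b, Inr (sep c)} \<in> red (hat_trigraph (part G B t) (adhesion_sets T B))"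
    unfolding hat_trigraph_def using assms(3) by simp blast
  then show ?thesis by (simp add: insert_commute)
qed

text \<open>Own vertices sit alone at their copies \<open>Inl a\<close>, so one flag suffices. A
  vertex below a child \<open>c\<close> sits at \<open>Inr (sep c)\<close>, which has no black
  edges; its own neighbours at \<open>t\<close> lie in \<open>sep c\<close> and are thus reached
  along red edges. Children with equal adhesion sets share a bundle.\<close>

lemma tww_le_hat:
  assumes "adhesion T B \<le> k"
    and "\<And>t. t \<in> verts T \<Longrightarrow> tww (hat_trigraph (part G B t) (adhesion_sets T B)) \<le> w"
  shows "tww (trigraph_of G) \<le> 2 ^ k * (w + 2)"
proof -
  let ?H = "\<lambda>t. hat_trigraph (part G B t) (adhesion_sets T B)"
  have "tww (trigraph_of G) \<le> 2 ^ k * 1 * (w + 2)"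
  proof (rule tww_le_parts[where H = ?H and \<beta> = hat_vertex and \<phi> = "\<lambda>_ _. ()" and z = undefined
        and \<gamma> = "\<lambda>_ _. True", OF assms(1) _ _ assms(2)])
    fix t assume t: "t \<in> verts T"
    show "wf_trigraph (?H t)" by (rule wf_hat_trigraph[OF part_simple])
    show "hat_vertex t ` below t \<subseteq> insert undefined (tverts (?H t))"
    proof (rule image_subsetI)
      fix a assume "a \<in> below t"
      with t show "hat_vertex t a \<in> insert undefined (tverts (?H t))"
      proof (cases rule: below_cases)
        case 1
        then show ?thesis
          using own_bag[OF 1(1)] by (simp add: hat_vertex_def hat_trigraph_def verts_part[OF t])
      next
        case 2
        then show ?thesis
          using sep_adhesion_set[OF 2(1)] sep_subset(1)[OF 2(1)]
          by (simp add: hat_vertex_def hat_trigraph_def verts_part[OF t])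
      qed
    qed
    show "models G (below t) (?H t) (hat_vertex t) (\<lambda>a. (nbrs_in G (sep t) a, ())) (\<lambda>_ _. True)"
      unfolding models_def
    proof (intro ballI impI)
      fix a b
      assume a: "a \<in> below t" and b: "b \<in> below t" and ne: "hat_vertex t a \<noteq> hat_vertex t b"
        and nonred: "{hat_vertex t a, hat_vertex t b} \<notin> red (?H t)"
      have mixed_case: "{u, v} \<notin> edges G \<and> {hat_vertex t u, hat_vertex t v} \<notin> black (?H t)"
        if u: "child_of t u \<in> children t" "u \<in> below (child_of t u)" "home u \<noteq> t"
          and v: "v \<in> own t" "home v = t" and nr: "{hat_vertex t u, hat_vertex t v} \<notin> red (?H t)" for u v
      proof -
        have hv: "hat_vertex t u = Inr (sep (child_of t u))" "hat_vertex t v = Inl v"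
          using u(3) v(2) by (auto simp: hat_vertex_def)
        have "v \<notin> sep (child_of t u)" using hat_red[OF t u(1)] nr unfolding hv by blast
        then show ?thesis using not_adjacent_own[OF t u(1,2) v(1)] hat_black(2) unfolding hv by blast
      qed
      have "{a, b} \<in> edges G \<longleftrightarrow> {hat_vertex t a, hat_vertex t b} \<in> black (?H t)"
        using t a
      proof (cases rule: below_cases)
        case a: 1
        show ?thesis using t b
        proof (cases rule: below_cases)
          case 1
          then show ?thesis
            using a part_edge_iff[OF own_bag own_bag] by (simp add: hat_vertex_def hat_black)
        next
          case 2
          then show ?thesis using mixed_case[OF 2(1-3) a] nonred by (simp add: insert_commute)
        qed
      next
        case a: 2
        show ?thesis using t b
        proof (cases rule: below_cases)
          case 1
          then show ?thesis using mixed_case[OF a(1-3) 1 nonred] by simp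
        next
          case 2
          have "child_of t a \<noteq> child_of t b" using ne a(3) 2(3) by (auto simp: hat_vertex_def)
          then have "{a, b} \<notin> edges G" by (rule not_adjacent_children[OF t a(1,2) 2(1,2)])
          then show ?thesis using a(3) hat_black(2) by (auto simp: hat_vertex_def)
        qed
      qed
      then show "{a, b} \<in> edges G \<longleftrightarrow> {hat_vertex t a, hat_vertex t b} \<in> black (?H t) \<and> True" by simp
    qed
    show "b = u" if "u \<in> own t" "hat_vertex t b = hat_vertex t u" for u b
      using that by (auto simp: hat_vertex_def own_def split: if_splits)
    show "hat_vertex t a = hat_vertex t b \<and> () = ()"
      if c: "c \<in> children t" and a: "a \<in> below c" and b: "b \<in> below c" for c a b
    proof -
      have "home a \<noteq> t" "home b \<noteq> t"
        using own_child_disjoint[OF c] a b by (auto simp: own_def below_def)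
      then show ?thesis using child_of_eq[OF c] a b by (simp add: hat_vertex_def)
    qed
    show "finite ((\<lambda>_. ()) ` below t) \<and> card ((\<lambda>_. ()) ` below t) \<le> 1"
      using card_mono[of "{()}" "(\<lambda>_. ()) ` below t"] by (simp add: subset_iff)
  qed simp
  then show ?thesis by simp
qed

section \<open>Bundling for the barred parts\<close>

definition bar_vertex :: "'t \<Rightarrow> 'a \<Rightarrow> 'a" where
  "bar_vertex t a = (if home a = t then a else SOME s. s \<in> sep (child_of t a))"

lemma bar_red:
  assumes "t \<in> verts T" "c \<in> children t" "a \<in> sep c" "b \<in> sep c" "a \<noteq> b"
  shows "{a, b} \<in> red (bar_trigraph (part G B t) (adhesion_sets T B))"
  using assms sep_adhesion_set[OF assms(2)] sep_subset(1)[OF assms(2)]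
  unfolding bar_trigraph_def Let_def by (auto simp: verts_part)

text \<open>What hangs below a child is bundled at one vertex of its adhesion set, if there is one.
  The rest of that set is joined to this vertex by red edges, which cover all adjacencies to own
  vertices in other bundles. The flag keeps an own vertex apart from what is bundled with it, and
  \<open>\<gamma>\<close> restricts black edges to pairs of own vertices. The two flag values give
  the factor 2.\<close>

lemma tww_le_bar:
  assumes "adhesion T B \<le> k"
    and "\<And>t. t \<in> verts T \<Longrightarrow> tww (bar_trigraph (part G B t) (adhesion_sets T B)) \<le> w"
  shows "tww (trigraph_of G) \<le> 2 ^ k * 2 * (w + 2)"
proof -
  let ?H = "\<lambda>t. bar_trigraph (part G B t) (adhesion_sets T B)"
  \<comment> \<open>The value of \<open>bar_vertex\<close> below children with empty adhesion set,
    the same at every node.\<close>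
  define z :: 'a where "z = (SOME s. s \<in> {})"
  show ?thesis
  proof (rule tww_le_parts[where H = ?H and \<beta> = bar_vertex and \<phi> = "\<lambda>t a. home a = t" and z = z
        and \<gamma> = "\<lambda>x y. snd x \<and> snd y", OF assms(1) _ _ assms(2)])
    fix t assume t: "t \<in> verts T"
    show "wf_trigraph (?H t)" by (rule wf_bar_trigraph[OF part_simple])
    have tv: "tverts (?H t) = B t" by (simp add: bar_trigraph_def Let_def verts_part[OF t])
    have some: "bar_vertex t a \<in> sep (child_of t a)" if "home a \<noteq> t" "sep (child_of t a) \<noteq> {}" for a
      using that by (simp add: bar_vertex_def some_in_eq)
    show "bar_vertex t ` below t \<subseteq> insert z (tverts (?H t))"
    proof (rule image_subsetI)
      fix a assume "a \<in> below t"
      with t show "bar_vertex t a \<in> insert z (tverts (?H t))"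
      proof (cases rule: below_cases)
        case 1
        then show ?thesis using own_bag tv by (simp add: bar_vertex_def)
      next
        case 2
        show ?thesis
        proof (cases "sep (child_of t a) = {}")
          case True
          then show ?thesis using 2(3) by (simp add: bar_vertex_def z_def)
        next
          case False
          then show ?thesis using some[OF 2(3)] sep_subset(1)[OF 2(1)] tv by blast
        qed
      qed
    qed
    show "models G (below t) (?H t) (bar_vertex t) (\<lambda>a. (nbrs_in G (sep t) a, home a = t))
        (\<lambda>x y. snd x \<and> snd y)"
      unfolding models_def snd_conv
    proof (intro ballI impI)
      fix a b
      assume a: "a \<in> below t" and b: "b \<in> below t" and ne: "bar_vertex t a \<noteq> bar_vertex t b"
        and nonred: "{bar_vertex t a, bar_vertex t b} \<notin> red (?H t)"
      have mixed_case: "{u, v} \<notin> edges G"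
        if u: "child_of t u \<in> children t" "u \<in> below (child_of t u)" "home u \<noteq> t"
          and v: "v \<in> own t" "home v = t" and d: "bar_vertex t u \<noteq> bar_vertex t v"
          and nr: "{bar_vertex t u, bar_vertex t v} \<notin> red (?H t)" for u v
      proof (rule not_adjacent_own[OF t u(1,2) v(1)])
        have "bar_vertex t v = v" using v(2) by (simp add: bar_vertex_def)
        then show "v \<notin> sep (child_of t u)" using bar_red[OF t u(1)] some[OF u(3)] d nr by auto
      qed
      show "{a, b} \<in> edges G \<longleftrightarrow>
          {bar_vertex t a, bar_vertex t b} \<in> black (?H t) \<and> home a = t \<and> home b = t"
        using t a
      proof (cases rule: below_cases)
        case a: 1
        show ?thesis using t b
        proof (cases rule: below_cases)
          case 1
          have ab: "bar_vertex t a = a" "bar_vertex t b = b"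
            using a(2) 1(2) by (simp_all add: bar_vertex_def)
          show ?thesis
            using bar_black[OF nonred[unfolded ab]] part_edge_iff[OF own_bag[OF a(1)] own_bag[OF 1(1)]]
              a(2) 1(2) by (simp add: ab)
        next
          case 2
          then show ?thesis using mixed_case[OF 2(1-3) a] ne nonred by (simp add: insert_commute)
        qed
      next
        case a: 2
        show ?thesis using t b
        proof (cases rule: below_cases)
          case 1
          then show ?thesis using mixed_case[OF a(1-3) 1 ne nonred] a(3) by simp
        next
          case 2
          have "child_of t a \<noteq> child_of t b" using ne a(3) 2(3) by (auto simp: bar_vertex_def)
          then have "{a, b} \<notin> edges G" by (rule not_adjacent_children[OF t a(1,2) 2(1,2)])
          then show ?thesis using a(3) by simp
        qed
      qed
    qed
    show "b = u" if "u \<in> own t" "bar_vertex t b = bar_vertex t u" "(home b = t) = (home u = t)" for u b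
      using that by (simp add: bar_vertex_def own_def)
    show "bar_vertex t a = bar_vertex t b \<and> (home a = t) = (home b = t)"
      if c: "c \<in> children t" and a: "a \<in> below c" and b: "b \<in> below c" for c a b
    proof -
      have "home a \<noteq> t" "home b \<noteq> t"
        using own_child_disjoint[OF c] a b by (auto simp: own_def below_def)
      then show ?thesis using child_of_eq[OF c] a b by (simp add: bar_vertex_def)
    qed
    show "finite ((\<lambda>a. home a = t) ` below t) \<and> card ((\<lambda>a. home a = t) ` below t) \<le> 2"
      using card_mono[of "UNIV :: bool set" "(\<lambda>a. home a = t) ` below t"] by simp
  qed simp
qed

end

text \<open>For \<open>w \<le> 2 * c\<close> the constant term suffices; beyond that
  \<open>w ^ n \<ge> w ^ 2 \<ge> 2 * c * w\<close>, where \<open>n \<ge> 2\<close> enters.\<close>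

lemma linear_le_power:
  fixes c :: real and w n :: nat
  assumes "1 \<le> c" "2 \<le> n"
  shows "2 * (real w + 2) \<le> real w ^ n / c + 2 * (2 * c + 2)"
proof (cases "real w \<le> 2 * c")
  case True
  have "2 * (real w + 2) \<le> 2 * (2 * c + 2)" using True by simp
  moreover have "0 \<le> real w ^ n / c" using assms by simp
  ultimately show ?thesis by (metis add_increasing)
next
  case False
  have "2 * c * real w \<le> real w * real w" using False by (intro mult_right_mono) auto
  also have "\<dots> \<le> real w ^ n"
    using power_increasing[of 2 n "real w"] assms False by (simp add: power2_eq_square)
  finally have "2 * real w \<le> real w ^ n / c" using assms by (simp add: field_simps)
  then show ?thesis using assms by simp
qed

theorem theorem5:
  fixes k :: nat
  shows "\<exists>D D' :: real. \<forall>(G :: 'a graph) (T :: 't graph) (B :: 't \<Rightarrow> 'a set).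
    simple_graph G \<longrightarrow> tree_decomposition G T B \<longrightarrow> adhesion T B = k \<longrightarrow>
      real (tww (trigraph_of G)) \<le>
        2 ^ k * real (Max ((\<lambda>t. tww (hat_trigraph (part G B t) (adhesion_sets T B))) ` verts T)) + D
      \<and>
      (3 \<le> k \<longrightarrow>
        real (tww (trigraph_of G)) \<le>
          2 ^ k / fact (k - 1) *
            real (Max ((\<lambda>t. tww (bar_trigraph (part G B t) (adhesion_sets T B))) ` verts T)) ^ (k - 1) + D')"
proof (intro exI allI impI)
  fix G :: "'a graph" and T :: "'t graph" and B :: "'t \<Rightarrow> 'a set"
  assume G: "simple_graph G" and dec: "tree_decomposition G T B" and adh: "adhesion T B = k"
  have tree: "is_tree T" using dec by (simp add: tree_decomposition_def)
  obtain r par and rank :: "'t \<Rightarrow> nat" where root: "r \<in> verts T"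
      "\<forall>t \<in> verts T - {r}. par t \<in> verts T \<and> rank (par t) < rank t"
      "edges T = {{t, par t} | t. t \<in> verts T - {r}}"
    using tree_parent[OF tree] by blast
  interpret rooted_decomposition G T B r par rank
    using G dec root by unfold_locales auto
  let ?hat = "\<lambda>t. tww (hat_trigraph (part G B t) (adhesion_sets T B))"
  let ?bar = "\<lambda>t. tww (bar_trigraph (part G B t) (adhesion_sets T B))"
  define wh wb where "wh = Max (?hat ` verts T)" and "wb = Max (?bar ` verts T)"
  have "?hat t \<le> wh" "?bar t \<le> wb" if "t \<in> verts T" for t
    using that finite_tree unfolding wh_def wb_def by auto
  then have nat: "tww (trigraph_of G) \<le> 2 ^ k * (wh + 2)" "tww (trigraph_of G) \<le> 2 ^ k * 2 * (wb + 2)"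
    using tww_le_hat tww_le_bar adh by auto
  have hat: "real (tww (trigraph_of G)) \<le> 2 ^ k * real wh + 2 ^ k * 2"
    using of_nat_mono[OF nat(1), where 'a = real] by (simp add: algebra_simps)
  have bar: "real (tww (trigraph_of G)) \<le>
      2 ^ k / fact (k - 1) * real wb ^ (k - 1) + 2 ^ k * (2 * (2 * fact (k - 1) + 2))" if "3 \<le> k"
  proof -
    have "real (tww (trigraph_of G)) \<le> 2 ^ k * (2 * (real wb + 2))"
      using of_nat_mono[OF nat(2), where 'a = real] by (simp add: algebra_simps)
    \<comment> \<open>This is \<open>linear_le_power\<close> with \<open>c = fact (k - 1)\<close>
      and \<open>n = k - 1\<close>, which is at least 2 since \<open>k \<ge> 3\<close>.\<close>
    also have "\<dots> \<le> 2 ^ k * (real wb ^ (k - 1) / fact (k - 1) + 2 * (2 * fact (k - 1) + 2))"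
      using that by (intro mult_left_mono linear_le_power) (auto simp: fact_ge_1)
    finally show ?thesis by (simp add: algebra_simps)
  qed
  \<comment> \<open>The constants left open by \<open>exI\<close> are fixed here; both depend on
    \<open>k\<close> alone.\<close>
  show "real (tww (trigraph_of G)) \<le> 2 ^ k * real (Max (?hat ` verts T)) + 2 ^ k * 2 \<and>
      (3 \<le> k \<longrightarrow> real (tww (trigraph_of G)) \<le>
        2 ^ k / fact (k - 1) * real (Max (?bar ` verts T)) ^ (k - 1) + 2 ^ k * (2 * (2 * fact (k - 1) + 2)))"
    using hat bar unfolding wh_def wb_def by blast
qed

end
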